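(* Let $a,b$ be real numbers with $a>0$, $1/2\le b<1$ and $a+b\neq 1$. Then the equality $$\frac{a}{\pi}\int_{-\infty}^{\infty}\frac{\ln\bigl|\zeta(b+it)\,(b-1+it)\bigr|}{a^2+t^2}\,dt=\ln\bigl|\zeta(a+b)\,(a+b-1)\bigr|$$ holds if and only if the Riemann zeta function $\zeta$ has no zeros $\sigma+it$ with $\sigma>b$. In particular, for $b=1/2$ this equality is equivalent to the Riemann hypothesis.
   Context: $\zeta$ denotes the Riemann zeta function. The Riemann hypothesis is the statement that all non-trivial zeros of $\zeta$ have real part $1/2$; equivalently, $\zeta$ has no zeros with real part $>1/2$. *)

theory Defs
  imports "HOL-Complex_Analysis.Complex_Analysis"
begin

text \<open>The Riemann zeta function: the (unique, by the identity theorem) holomorphic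
  function on the complex plane minus the point 1 that agrees with the Dirichlet series
  sum over n of n to the power minus s on the half-plane Re s > 1.  Its value at the pole
  s = 1 is irrelevant (unspecified).\<close>
definition riemann_zeta :: "complex \<Rightarrow> complex" where
  "riemann_zeta = (SOME f. f holomorphic_on (- {1}) \<and>
      (\<forall>s. 1 < Re s \<longrightarrow> f s = (\<Sum>n. inverse (of_nat (Suc n) powr s))))"

end

theory Submission
  imports Defs "HOL-Real_Asymp.Real_Asymp"
begin

text \<open>
  Put \<open>F s = (s - 1) \<zeta>(s)\<close>, an entire function of quadratic growth for \<open>Re s \<ge> 1/2\<close>. The Cayley
  transform \<open>s = b + a (1 + w) / (1 - w)\<close> maps the unit disc to the half-plane \<open>Re s > b\<close>, the origin
  to \<open>a + b\<close>, and normalised arc length to the Poisson kernel on \<open>Re s = b\<close>. So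
  \<open>K w = F s (1 - w)\<^sup>2 / C\<close> is holomorphic off \<open>1\<close> and bounded by \<open>1\<close> in the disc, and the equality
  says that \<open>ln |K 0|\<close> is the mean of \<open>ln |K|\<close> over the unit circle.
  Jensen's inequality on circles of radius \<open>r < 1\<close> and Fatou's lemma show that the boundary mean
  is finite and at least \<open>ln |K 0|\<close>, and each zero \<open>\<rho>\<close> in the disc adds \<open>ln (1 / |\<rho>|)\<close>. If there are no
  zeros, \<open>- ln |K|\<close> is a positive harmonic function. Away from \<open>1\<close> its values on the circles of
  radius \<open>r\<close> converge dominatedly as \<open>r \<rightarrow> 1\<close>, and the mass near \<open>1\<close> is controlled by the Poisson
  formula at real \<open>x \<rightarrow> 1\<close>, because \<open>|F|\<close> is at least \<open>1\<close> far out on the real axis.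

  The continuation of \<open>F\<close> is obtained by summing the Taylor expansions of \<open>x powr (1 - s)\<close> from \<open>n\<close> to
  \<open>n + 1\<close>: this expresses \<open>F s\<close> by the values \<open>F (s + k)\<close>, \<open>k \<ge> 1\<close>, and a series converging in a
  larger half-plane.
\<close>

section \<open>Analytic continuation and growth of the zeta function\<close>

text \<open>The remainder of order \<open>N\<close> in the Taylor expansion of \<open>x powr (1 - s)\<close> from \<open>n + 1\<close> to \<open>n + 2\<close>.\<close>

definition zeta_term :: "nat \<Rightarrow> nat \<Rightarrow> complex \<Rightarrow> complex" where
  "zeta_term N n s = of_nat (n + 2) powr (1 - s)
     - (\<Sum>j\<le>N. ((1 - s) gchoose j) * of_nat (n + 1) powr (1 - s - of_nat j))"

lemma zeta_term_1:
  "zeta_term 1 n s = of_nat (n + 2) powr (1 - s) - of_nat (n + 1) powr (1 - s) - (1 - s) * of_nat (n + 1) powr (- s)"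
  by (simp add: zeta_term_def)

lemma gbinomial_step:
  fixes a :: "'a :: field_char_0"
  shows "of_nat (Suc k) * (a gchoose Suc k) = (a gchoose k) * (a - of_nat k)"
  using gbinomial_mult_1[of a k] by (simp add: algebra_simps)

text \<open>Taylor's theorem for \<open>x powr (1 - s)\<close> on the segment from
  \<open>n + 1\<close> to \<open>n + 2\<close>. The hypothesis makes the exponent of the derivative
  of order \<open>N + 1\<close> have nonpositive real part, so its modulus is largest at the left
  endpoint.\<close>

lemma norm_zeta_term_le:
  assumes s: "Re s \<ge> - real N"
  shows "cmod (zeta_term N n s)
    \<le> real (N + 1) * cmod ((1 - s) gchoose (N + 1)) * real (n + 1) powr (- Re s - real N)"
proof -
  define m where "m = real (n + 1)"
  have m: "m \<ge> 1" by (simp add: m_def)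
  define S where "S = closed_segment (complex_of_real m) (of_real (m + 1))"
  have Sx: "\<exists>u\<ge>m. x = of_real u" if "x \<in> S" for x
    using that unfolding S_def closed_segment_of_real by (auto simp: closed_segment_eq_real_ivl)
  \<comment> \<open>\<open>f i\<close> is the derivative of order \<open>i\<close> of
    \<open>x powr (1 - s)\<close>.\<close>
  define f where "f = (\<lambda>i x. fact i * ((1 - s) gchoose i) * x powr (1 - s - of_nat i))"
  define B where "B = fact (Suc N) * cmod ((1 - s) gchoose (N + 1)) * m powr (- Re s - real N)"
  have "cmod (f 0 (of_real (m + 1)) - (\<Sum>i\<le>N. f i (of_real m) * (of_real (m + 1) - of_real m) ^ i / fact i))
     \<le> B * cmod (of_real (m + 1) - of_real m) ^ Suc N / fact N"
  proof (rule complex_Taylor[of S])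
    show "convex S" by (simp add: S_def)
    show "of_real m \<in> S" "of_real (m + 1) \<in> S" by (simp_all add: S_def)
    show "cmod (f (Suc N) x) \<le> B" if xS: "x \<in> S" for x
    proof -
      obtain u where u: "u \<ge> m" "x = of_real u" using Sx[OF xS] by blast
      have "cmod (x powr (1 - s - of_nat (Suc N))) = u powr (- Re s - real N)"
        using u m by (simp add: norm_powr_real_powr)
      also have "\<dots> \<le> m powr (- Re s - real N)"
        using u m s by (intro powr_mono2') auto
      finally show ?thesis
        unfolding f_def B_def by (auto simp: norm_mult intro!: mult_left_mono simp del: fact_Suc)
    qed
    show "(f i has_field_derivative f (Suc i) x) (at x within S)" if xS: "x \<in> S" and "i \<le> N" for i x
    proof -
      obtain u where u: "u \<ge> m" "x = of_real u" using Sx[OF xS] by blast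
      then have "x \<notin> \<real>\<^sub>\<le>\<^sub>0" using m by (simp add: complex_nonpos_Reals_iff)
      then have "(f i has_field_derivative
          fact i * ((1 - s) gchoose i) * ((1 - s - of_nat i) * x powr (1 - s - of_nat i - 1))) (at x)"
        unfolding f_def by (intro DERIV_cmult has_field_derivative_powr)
      moreover have "fact i * ((1 - s) gchoose i) * ((1 - s - of_nat i) * x powr (1 - s - of_nat i - 1)) = f (Suc i) x"
      proof -
        have "1 - s - of_nat i - 1 = 1 - s - of_nat (Suc i)" by simp
        then show ?thesis
          unfolding f_def fact_Suc
          using arg_cong[OF gbinomial_step[of i "1 - s"], of "\<lambda>c. fact i * c * x powr (1 - s - of_nat (Suc i))"]
          by (simp only: mult_ac)
      qed
      ultimately show ?thesis
        by (simp add: has_field_derivative_at_within)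
    qed
  qed
  moreover have "f 0 (of_real (m + 1)) - (\<Sum>i\<le>N. f i (of_real m) * (of_real (m + 1) - of_real m) ^ i / fact i)
      = zeta_term N n s"
    by (simp add: zeta_term_def f_def m_def algebra_simps)
  \<comment> \<open>The Taylor bound divides by \<open>fact N\<close> only, while \<open>B\<close>
    contains \<open>fact (Suc N)\<close>; the quotient is the factor \<open>N + 1\<close>.\<close>
  moreover have "B * cmod (of_real (m + 1) - of_real m) ^ Suc N / fact N
      = real (N + 1) * cmod ((1 - s) gchoose (N + 1)) * real (n + 1) powr (- Re s - real N)"
    by (simp add: B_def m_def)
  ultimately show ?thesis by (simp only:)
qed

lemma holomorphic_gbinomial [holomorphic_intros]:
  assumes "f holomorphic_on A"
  shows "(\<lambda>s. (f s gchoose k) :: complex) holomorphic_on A"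
  unfolding gbinomial_prod_rev by (intro holomorphic_intros assms) auto

lemma holomorphic_zeta_term: "zeta_term N n holomorphic_on A"
  unfolding zeta_term_def[abs_def] by (intro holomorphic_intros) (auto simp: complex_nonpos_Reals_iff)

lemma summable_Suc_powr: "e < -1 \<Longrightarrow> summable (\<lambda>n. real (n + 1) powr e)"
  using summable_Suc_iff[of "\<lambda>n. real n powr e"] summable_real_powr_iff[of e] by simp

lemma summable_zeta_term:
  assumes "Re s > 1 - real N"
  shows "summable (\<lambda>n. zeta_term N n s)"
proof (rule summable_comparison_test')
  show "summable (\<lambda>n. real (N + 1) * cmod ((1 - s) gchoose (N + 1)) * real (n + 1) powr (- Re s - real N))"
    using assms by (intro summable_mult summable_Suc_powr) auto
  show "norm (zeta_term N n s) \<le> real (N + 1) * cmod ((1 - s) gchoose (N + 1)) * real (n + 1) powr (- Re s - real N)" for n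
    using assms by (intro norm_zeta_term_le) auto
qed

text \<open>The M-test gives local uniform convergence. The radius \<open>d\<close> is half the
  distance to the boundary line, so on the disc the exponent of \<open>n + 1\<close> stays at most
  \<open>- 1 - d\<close>, while the binomial factor is bounded by compactness.\<close>

lemma holomorphic_suminf_zeta_term:
  "(\<lambda>s. \<Sum>n. zeta_term N n s) holomorphic_on {s. Re s > 1 - real N}"
proof (rule holomorphic_uniform_sequence[where f = "\<lambda>n s. \<Sum>i<n. zeta_term N i s"])
  show "open {s. Re s > 1 - real N}" by (rule open_halfspace_Re_gt)
  show "(\<lambda>s. \<Sum>i<n. zeta_term N i s) holomorphic_on {s. Re s > 1 - real N}" for n
    by (intro holomorphic_intros holomorphic_zeta_term)
next
  fix s0 assume s0: "s0 \<in> {s. Re s > 1 - real N}"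
  define d where "d = (Re s0 - (1 - real N)) / 2"
  have d: "d > 0" using s0 by (simp add: d_def)
  have Re: "Re s \<ge> 1 - real N + d" if "s \<in> cball s0 d" for s
    using that abs_Re_le_cmod[of "s0 - s"] by (simp add: d_def dist_norm field_simps)
  have "bounded ((\<lambda>s. (1 - s) gchoose (N + 1)) ` cball s0 d)"
    by (intro compact_imp_bounded compact_continuous_image holomorphic_on_imp_continuous_on
        holomorphic_intros compact_cball)
  then obtain M where M: "\<And>s. s \<in> cball s0 d \<Longrightarrow> cmod ((1 - s) gchoose (N + 1)) \<le> M"
    unfolding bounded_iff by blast
  have M0: "M \<ge> 0" using M[of s0] d norm_ge_zero order_trans by (metis centre_in_cball less_eq_real_def)
  have "uniform_limit (cball s0 d) (\<lambda>n s. \<Sum>i<n. zeta_term N i s) (\<lambda>s. \<Sum>n. zeta_term N n s) sequentially"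
  proof (rule Weierstrass_m_test)
    fix n s assume s: "s \<in> cball s0 d"
    have "cmod (zeta_term N n s)
      \<le> real (N + 1) * cmod ((1 - s) gchoose (N + 1)) * real (n + 1) powr (- Re s - real N)"
      using Re[OF s] d by (intro norm_zeta_term_le) auto
    also have "\<dots> \<le> real (N + 1) * M * real (n + 1) powr (- 1 - d)"
      using M[OF s] M0 Re[OF s] by (intro mult_mono powr_mono) auto
    finally show "cmod (zeta_term N n s) \<le> real (N + 1) * M * real (n + 1) powr (- 1 - d)" .
  next
    show "summable (\<lambda>n. real (N + 1) * M * real (n + 1) powr (- 1 - d))"
      using d by (intro summable_mult summable_Suc_powr) auto
  qed
  moreover have "cball s0 d \<subseteq> {s. Re s > 1 - real N}" using Re d by force
  ultimately show "\<exists>d>0. cball s0 d \<subseteq> {s. Re s > 1 - real N} \<and>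
      uniform_limit (cball s0 d) (\<lambda>n s. \<Sum>i<n. zeta_term N i s) (\<lambda>s. \<Sum>n. zeta_term N n s) sequentially"
    using d by blast
qed

section \<open>The Dirichlet series, its shift recurrence and the entire continuation\<close>

definition zeta_series :: "complex \<Rightarrow> complex" where
  "zeta_series s = (\<Sum>n. inverse (of_nat (Suc n) powr s))"

lemma zeta_series_sums:
  assumes "Re s > 1"
  shows "(\<lambda>n. of_nat (n + 1) powr (- s)) sums zeta_series s"
proof -
  have "summable (\<lambda>n. of_nat (n + 1) powr (- s))"
  proof (rule summable_comparison_test')
    show "summable (\<lambda>n. real (n + 1) powr (- Re s))" using assms by (intro summable_Suc_powr) auto
    show "norm (of_nat (n + 1) powr (- s)) \<le> real (n + 1) powr (- Re s)" for n
      using norm_powr_real_powr[of "of_nat (n + 1)" "-s"] by simp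
  qed
  then show ?thesis
    by (auto simp: zeta_series_def powr_minus sums_iff add.commute)
qed

text \<open>The \<open>j = 0\<close> part of the Taylor remainder telescopes to \<open>- 1\<close>,
  because \<open>(n + 1) powr (1 - s)\<close> tends to zero; each later \<open>j\<close> sums to a
  Dirichlet series at \<open>s + j - 1\<close>.\<close>

lemma suminf_zeta_term:
  assumes s: "Re s > 1"
  shows "(\<Sum>n. zeta_term N n s) = - 1 - (\<Sum>j=1..N. ((1 - s) gchoose j) * zeta_series (s + of_nat j - 1))"
proof -
  have lim: "(\<lambda>n. of_nat (n + 1) powr (1 - s)) \<longlonglongrightarrow> 0"
  proof (rule tendsto_norm_zero_cancel)
    have "(\<lambda>n. real (n + 1) powr (1 - Re s)) \<longlonglongrightarrow> 0"
    proof (rule tendsto_neg_powr)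
      show "filterlim (\<lambda>n. real (n + 1)) at_top sequentially"
        using filterlim_compose[OF filterlim_real_sequentially filterlim_Suc] by simp
    qed (use s in auto)
    moreover have "cmod (of_nat (n + 1) powr (1 - s)) = real (n + 1) powr (1 - Re s)" for n
      using norm_powr_real_powr[of "of_nat (n + 1)" "1-s"] by simp
    ultimately show "(\<lambda>n. cmod (of_nat (n + 1) powr (1 - s))) \<longlonglongrightarrow> 0" by simp
  qed
  have tele: "(\<lambda>n. of_nat (n + 2) powr (1 - s) - of_nat (n + 1) powr (1 - s)) sums (0 - 1)"
    using telescope_sums[OF lim] by (simp add: add_ac)
  have "(\<lambda>n. \<Sum>j=1..N. ((1 - s) gchoose j) * of_nat (n + 1) powr (1 - s - of_nat j))
        sums (\<Sum>j=1..N. ((1 - s) gchoose j) * zeta_series (s + of_nat j - 1))"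
  proof (intro sums_sum sums_mult)
    fix j assume "j \<in> {1..N}"
    then show "(\<lambda>n. of_nat (n + 1) powr (1 - s - of_nat j)) sums zeta_series (s + of_nat j - 1)"
      using zeta_series_sums[of "s + of_nat j - 1"] s by (simp add: algebra_simps)
  qed
  from sums_diff[OF tele this]
  have "(\<lambda>n. zeta_term N n s) sums (- 1 - (\<Sum>j=1..N. ((1 - s) gchoose j) * zeta_series (s + of_nat j - 1)))"
    by (simp add: zeta_term_def atMost_atLeast0 sum.atLeast_Suc_atMost diff_diff_eq)
  then show ?thesis by (simp add: sums_iff)
qed

text \<open>The \<open>j = 1\<close> summand is isolated on the left. In the others
  \<open>j = k + 1\<close>, and the binomial coefficient supplies the factor
  \<open>1 - s - k\<close>, exactly what cancels the pole of \<open>zeta_series (s + k)\<close> at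
  \<open>s + k = 1\<close>. Thus only values of the regularised function at shifted points
  occur.\<close>

lemma zeta_series_recurrence:
  assumes s: "Re s > 1" and N: "N \<ge> 1"
  shows "(s - 1) * zeta_series s = 1 + (\<Sum>n. zeta_term N n s)
     - (\<Sum>k=1..<N. ((1 - s) gchoose k) / of_nat (k + 1) * ((s + of_nat k - 1) * zeta_series (s + of_nat k)))"
proof -
  have "(\<Sum>j=1..N. ((1 - s) gchoose j) * zeta_series (s + of_nat j - 1))
     = (1 - s) * zeta_series s + (\<Sum>j=Suc 1..N. ((1 - s) gchoose j) * zeta_series (s + of_nat j - 1))"
    using N by (subst sum.atLeast_Suc_atMost) auto
  also have "(\<Sum>j=Suc 1..N. ((1 - s) gchoose j) * zeta_series (s + of_nat j - 1))
     = (\<Sum>k=1..<N. ((1 - s) gchoose Suc k) * zeta_series (s + of_nat k))"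
    using N by (cases N) (simp_all add: sum.shift_bounds_cl_Suc_ivl atLeastLessThanSuc_atLeastAtMost add_diff_eq del: sum.cl_ivl_Suc)
  also have "\<dots> = - (\<Sum>k=1..<N. ((1 - s) gchoose k) / of_nat (k + 1) * ((s + of_nat k - 1) * zeta_series (s + of_nat k)))"
    unfolding sum_negf[symmetric]
  proof (intro sum.cong refl)
    fix k
    have "((1 - s) gchoose Suc k) = ((1 - s) gchoose k) * (1 - s - of_nat k) / of_nat (k + 1)"
      using gbinomial_step[of k "1 - s"]
      by (metis nonzero_mult_div_cancel_left of_nat_neq_0 Suc_eq_plus1)
    then show "((1 - s) gchoose Suc k) * zeta_series (s + of_nat k)
      = - (((1 - s) gchoose k) / of_nat (k + 1) * ((s + of_nat k - 1) * zeta_series (s + of_nat k)))"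
      by (simp only:) (simp add: divide_simps, simp add: algebra_simps)
  qed
  finally have "(\<Sum>j=1..N. ((1 - s) gchoose j) * zeta_series (s + of_nat j - 1)) = (1 - s) * zeta_series s
     - (\<Sum>k=1..<N. ((1 - s) gchoose k) / of_nat (k + 1) * ((s + of_nat k - 1) * zeta_series (s + of_nat k)))"
    by simp
  then show ?thesis
    unfolding suminf_zeta_term[OF s, of N] by (simp only:) (simp only: ring_distribs, simp)
qed

text \<open>Each induction step gains a strip of width one. Order \<open>M + 2\<close> makes the
  remainder series converge for \<open>Re s > - (M + 1)\<close>, and the shifts \<open>s + k\<close>
  with \<open>k \<ge> 1\<close> fall into the half-plane where \<open>F\<close> is already
  holomorphic.\<close>

lemma zeta_halfplane_continuation:
  "\<exists>F. F holomorphic_on {s. Re s > - real M} \<and> (\<forall>s. Re s > 1 \<longrightarrow> F s = (s - 1) * zeta_series s)"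
proof (induction M)
  case 0
  show ?case
    using holomorphic_suminf_zeta_term[of 1] zeta_series_recurrence[of _ 1]
    by (intro exI[of _ "\<lambda>s. 1 + (\<Sum>n. zeta_term 1 n s)"]) (auto intro!: holomorphic_intros)
next
  case (Suc M)
  then obtain F where F: "F holomorphic_on {s. Re s > - real M}"
    and Feq: "\<And>s. Re s > 1 \<Longrightarrow> F s = (s - 1) * zeta_series s" by blast
  define F' where "F' = (\<lambda>s. 1 + (\<Sum>n. zeta_term (M + 2) n s)
     - (\<Sum>k=1..<M+2. ((1 - s) gchoose k) / of_nat (k + 1) * F (s + of_nat k)))"
  have "F' holomorphic_on {s. Re s > - real (Suc M)}"
    unfolding F'_def
  proof (intro holomorphic_intros)
    show "(\<lambda>s. \<Sum>n. zeta_term (M + 2) n s) holomorphic_on {s. Re s > - real (Suc M)}"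
      using holomorphic_suminf_zeta_term[of "M + 2"] by simp
  next
    fix k assume k: "k \<in> {1..<M+2}"
    have "(F \<circ> (\<lambda>s. s + of_nat k)) holomorphic_on {s. Re s > - real (Suc M)}"
      by (rule holomorphic_on_compose_gen[OF _ F]) (use k in \<open>auto intro!: holomorphic_intros\<close>)
    then show "(\<lambda>s. F (s + of_nat k)) holomorphic_on {s. Re s > - real (Suc M)}"
      by (simp add: o_def)
  qed (metis Suc_eq_plus1 of_nat_neq_0)
  moreover have "F' s = (s - 1) * zeta_series s" if s: "Re s > 1" for s
    unfolding F'_def zeta_series_recurrence[OF s, of "M + 2", simplified]
    using s by (simp add: Feq)
  ultimately show ?case by blast
qed

lemma zeta_entire_continuation:
  obtains F where "F holomorphic_on UNIV"
    and "\<And>s. Re s > 1 \<Longrightarrow> F s = (s - 1) * zeta_series s"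
proof -
  from zeta_halfplane_continuation obtain f
    where f: "\<And>M. f M holomorphic_on {s. Re s > - real M}"
      and feq: "\<And>M s. Re s > 1 \<Longrightarrow> f M s = (s - 1) * zeta_series s"
    by metis
  have agree: "f M s = f N s" if "Re s > - real M" "M \<le> N" for M N s
  proof (rule analytic_continuation_open[of "{s. Re s > 1}" "{s. Re s > - real M}" "f M" "f N"])
    show "f N holomorphic_on {s. Re s > - real M}"
      by (rule holomorphic_on_subset[OF f]) (use that in auto)
    show "{s. Re s > 1} \<noteq> {}" by (auto intro!: exI[of _ 2])
    show "connected {s. Re s > - real M}" by (intro convex_connected convex_halfspace_Re_gt)
  qed (use f feq that in \<open>auto simp: open_halfspace_Re_gt\<close>)
  \<comment> \<open>The index is large enough for \<open>s\<close> to lie in the half-plane of the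
    chosen continuation; by \<open>agree\<close> any other sufficient index gives the same
    value.\<close>
  define F where "F = (\<lambda>s. f (nat \<lceil>- Re s\<rceil> + 1) s)"
  have Ff: "F s = f M s" if "Re s > - real M" for s M
  proof -
    have "Re s > - real (nat \<lceil>- Re s\<rceil> + 1)" by linarith
    with that show ?thesis
      unfolding F_def by (metis agree linorder_le_cases)
  qed
  have "F holomorphic_on (\<Union>M. {s. Re s > - real M})"
  proof (rule holomorphic_on_UN_open)
    show "F holomorphic_on {s. Re s > - real M}" for M
      using f[of M] by (rule holomorphic_transform) (simp add: Ff)
  qed (simp add: open_halfspace_Re_gt)
  moreover have "(\<Union>M. {s. Re s > - real M}) = UNIV"
  proof -
    have "\<exists>M. Re s > - real M" for s :: complex
      using reals_Archimedean2[of "- Re s"] by (metis minus_less_iff)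
    then show ?thesis by auto
  qed
  ultimately have "F holomorphic_on UNIV" by simp
  moreover have "F s = (s - 1) * zeta_series s" if "Re s > 1" for s
    using feq[OF that] by (simp add: F_def)
  ultimately show thesis using that by blast
qed

section \<open>The zeta function of the definition and its regularisation at the pole\<close>

text \<open>The quotient of the entire continuation by \<open>s - 1\<close> is a witness for the
  choice operator, so the chosen function has both properties.\<close>

lemma riemann_zeta_spec:
  shows "riemann_zeta holomorphic_on (- {1})"
    and "Re s > 1 \<Longrightarrow> riemann_zeta s = zeta_series s"
proof -
  obtain F where F: "F holomorphic_on UNIV"
    and Feq: "\<And>s. Re s > 1 \<Longrightarrow> F s = (s - 1) * zeta_series s"
    by (rule zeta_entire_continuation) (rule that)
  have "(\<lambda>s. F s / (s - 1)) holomorphic_on (- {1})"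
    by (intro holomorphic_intros holomorphic_on_subset[OF F]) auto
  moreover have "\<forall>s. 1 < Re s \<longrightarrow> F s / (s - 1) = (\<Sum>n. inverse (of_nat (Suc n) powr s))"
    using Feq by (auto simp: zeta_series_def)
  ultimately have "\<exists>f. f holomorphic_on (- {1}) \<and>
      (\<forall>s. 1 < Re s \<longrightarrow> f s = (\<Sum>n. inverse (of_nat (Suc n) powr s)))"
    by blast
  from someI_ex[OF this] show "riemann_zeta holomorphic_on (- {1})"
    and "Re s > 1 \<Longrightarrow> riemann_zeta s = zeta_series s"
    by (simp_all add: riemann_zeta_def zeta_series_def)
qed

text \<open>The value at \<open>s = 1\<close> fills the removable singularity, the residue of zeta
  there being 1.\<close>

definition zeta_reg :: "complex \<Rightarrow> complex" where
  "zeta_reg s = (if s = 1 then 1 else (s - 1) * riemann_zeta s)"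

text \<open>The identity theorem is used twice: on \<open>Re s > 0\<close> it equates the
  continuation with the first-order remainder series, and on the plane without 1 with
  \<open>(s - 1) * riemann_zeta s\<close>.\<close>

lemma zeta_reg_holomorphic: "zeta_reg holomorphic_on UNIV"
  and zeta_reg_eq: "Re s > 0 \<Longrightarrow> zeta_reg s = 1 + (\<Sum>n. zeta_term 1 n s)"
proof -
  obtain F where F: "F holomorphic_on UNIV"
    and Feq: "\<And>s. Re s > 1 \<Longrightarrow> F s = (s - 1) * zeta_series s"
    by (rule zeta_entire_continuation) (rule that)
  have F1: "F s = 1 + (\<Sum>n. zeta_term 1 n s)" if "Re s > 0" for s
  proof (rule analytic_continuation_open[of "{s. Re s > 1}" "{s. Re s > 0}" F "\<lambda>s. 1 + (\<Sum>n. zeta_term 1 n s)"])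
    show "F holomorphic_on {s. Re s > 0}" by (rule holomorphic_on_subset[OF F]) auto
    show "(\<lambda>s. 1 + (\<Sum>n. zeta_term 1 n s)) holomorphic_on {s. Re s > 0}"
      using holomorphic_suminf_zeta_term[of 1] by (intro holomorphic_intros) auto
    show "{s. Re s > 1} \<noteq> {}" by (auto intro!: exI[of _ 2])
    show "connected {s. Re s > 0}" by (intro convex_connected convex_halfspace_Re_gt)
    show "F z = 1 + (\<Sum>n. zeta_term 1 n z)" if "z \<in> {s. Re s > 1}" for z
      using that zeta_series_recurrence[of z 1] Feq[of z] by simp
  qed (use that in \<open>auto simp: open_halfspace_Re_gt\<close>)
  \<comment> \<open>At \<open>s = 1\<close> the first two powers have exponent 0 and nonzero base,
    so they cancel, and the third summand has the factor \<open>1 - s\<close>.\<close>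
  have "zeta_term 1 n 1 = 0" for n
    using of_nat_neq_0[of "Suc n", where 'a = complex] of_nat_neq_0[of n, where 'a = complex]
    unfolding zeta_term_1 by (simp add: add.commute)
  then have "F 1 = 1"
    using F1[of 1] by simp
  moreover have "F s = (s - 1) * riemann_zeta s" if "s \<noteq> 1" for s
  proof (rule analytic_continuation_open[of "{s. Re s > 1}" "- {1}" F "\<lambda>s. (s - 1) * riemann_zeta s"])
    show "F holomorphic_on - {1}" by (rule holomorphic_on_subset[OF F]) auto
    show "(\<lambda>s. (s - 1) * riemann_zeta s) holomorphic_on - {1}"
      by (intro holomorphic_intros riemann_zeta_spec)
    show "{s. Re s > 1} \<noteq> {}" by (auto intro!: exI[of _ 2])
    show "connected (- {1::complex})" by (intro connected_punctured_universe) simp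
    show "F z = (z - 1) * riemann_zeta z" if "z \<in> {s. Re s > 1}" for z
      using that Feq[of z] riemann_zeta_spec(2)[of z] by simp
  qed (use that in \<open>auto simp: open_halfspace_Re_gt\<close>)
  ultimately have "F = zeta_reg" by (auto simp: zeta_reg_def)
  with F F1 show "zeta_reg holomorphic_on UNIV"
    and "Re s > 0 \<Longrightarrow> zeta_reg s = 1 + (\<Sum>n. zeta_term 1 n s)" by auto
qed

section \<open>Quadratic growth, and lower bounds on the real axis\<close>

text \<open>In the remainder bound with \<open>N = 1\<close> the binomial coefficient is
  \<open>(1 - s) (- s) / 2\<close>, which yields the quadratic factor, and
  \<open>Re s \<ge> 1/2\<close> leaves the convergent series with exponent
  \<open>- 3/2\<close>.\<close>

lemma zeta_reg_growth:
  obtains C where "C > 0" "\<And>s. Re s \<ge> 1/2 \<Longrightarrow> cmod (zeta_reg s) \<le> C * (1 + cmod s)\<^sup>2"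
proof -
  define c where "c = (\<Sum>n. real (n + 1) powr (- 3/2))"
  have sm: "summable (\<lambda>n. real (n + 1) powr (- 3/2))" by (rule summable_Suc_powr) simp
  have c0: "c \<ge> 0" unfolding c_def by (intro suminf_nonneg[OF sm]) simp
  show thesis
  proof
    show "1 + c > 0" using c0 by simp
    fix s assume s: "Re s \<ge> 1/2"
    define m where "m = (1 + cmod s)\<^sup>2"
    have bd: "cmod (zeta_term 1 n s) \<le> m * real (n + 1) powr (- 3/2)" for n
    proof -
      have "cmod (zeta_term 1 n s) \<le> 2 * cmod ((1 - s) gchoose 2) * real (n + 1) powr (- Re s - 1)"
        using norm_zeta_term_le[of 1 s n] s by (simp add: numeral_2_eq_2)
      also have "2 * cmod ((1 - s) gchoose 2) = cmod (1 - s) * cmod s"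
        by (simp add: gbinomial_prod_rev numeral_2_eq_2 norm_mult norm_divide)
      also have "cmod (1 - s) * cmod s * real (n + 1) powr (- Re s - 1)
          \<le> ((1 + cmod s) * (1 + cmod s)) * real (n + 1) powr (- 3/2)"
        using s norm_triangle_ineq4[of 1 s] by (intro mult_mono powr_mono) auto
      finally show ?thesis by (simp add: m_def power2_eq_square)
    qed
    have "cmod (\<Sum>n. zeta_term 1 n s) \<le> (\<Sum>n. m * real (n + 1) powr (- 3/2))"
      by (rule norm_suminf_le[OF bd summable_mult[OF sm]])
    also have "\<dots> = m * c" unfolding c_def by (rule suminf_mult[OF sm])
    finally have "cmod (zeta_reg s) \<le> 1 + m * c"
      using norm_triangle_ineq[of 1 "\<Sum>n. zeta_term 1 n s"] zeta_reg_eq[of s] s by simp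
    also have "1 \<le> m" by (simp add: m_def)
    finally show "cmod (zeta_reg s) \<le> (1 + c) * (1 + cmod s)\<^sup>2"
      by (simp add: m_def algebra_simps)
  qed
qed

lemma of_nat_Suc_powr_real: "of_nat (k + 1) powr complex_of_real y = of_real (real (k + 1) powr y)"
proof -
  have "of_real (real (k + 1)) powr complex_of_real y = of_real (real (k + 1) powr y)"
    by (rule powr_of_real) simp
  then show ?thesis by (simp only: of_real_of_nat_eq)
qed

text \<open>The Dirichlet series has nonnegative terms and first term 1. The bound serves for
  nonvanishing at \<open>a + b > 1\<close> and for the growth condition at the boundary point 1 of
  the disc.\<close>

lemma zeta_reg_real_ge:
  assumes x: "x > 1"
  shows "cmod (zeta_reg (of_real x)) \<ge> x - 1"
proof -
  have "(\<lambda>n. of_nat (n + 1) powr (- complex_of_real x)) sums zeta_series (of_real x)"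
    using x by (intro zeta_series_sums) simp
  moreover have "of_nat (n + 1) powr (- complex_of_real x) = of_real (real (n + 1) powr (- x))" for n
    using of_nat_Suc_powr_real[of n "- x"] by (simp only: of_real_minus)
  ultimately have "(\<lambda>n. complex_of_real (real (n + 1) powr (- x))) sums zeta_series (of_real x)"
    by (simp only:)
  then have "(\<lambda>n. real (n + 1) powr (- x)) sums Re (zeta_series (of_real x))"
    by (auto dest: sums_Re)
  from sum_le_suminf[OF sums_summable[OF this], of "{0}"] sums_unique[OF this] have "1 \<le> Re (zeta_series (of_real x))"
    by simp
  then have "1 \<le> cmod (zeta_series (of_real x))"
    using complex_Re_le_cmod order_trans by blast
  then have "(x - 1) * 1 \<le> (x - 1) * cmod (zeta_series (of_real x))"
    using x by (intro mult_left_mono) auto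
  also have "\<dots> = cmod (zeta_reg (of_real x))"
    using x riemann_zeta_spec(2)[of "of_real x"]
    by (simp add: zeta_reg_def norm_mult) (metis abs_of_pos diff_gt_0_iff_gt norm_of_real of_real_1 of_real_diff)
  finally show ?thesis by simp
qed

text \<open>This covers \<open>a + b < 1\<close>. By the mean value theorem each increment of
  \<open>p\<close> is at least the amount subtracted in the following term, so the partial sums of
  \<open>1 + \<Sum> t n\<close> never fall below \<open>x\<close>; hence the limit is at least
  \<open>x > 0\<close>.\<close>

lemma zeta_reg_unit_interval:
  assumes x: "0 < x" "x < 1"
  shows "zeta_reg (of_real x) \<noteq> 0"
proof -
  define p where "p = (\<lambda>n. real (n + 1) powr (1 - x))"
  define t where "t = (\<lambda>n. p (n + 1) - p n - (1 - x) * real (n + 1) powr (- x))"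
  have tz: "zeta_term 1 n (of_real x) = of_real (t n)" for n
  proof -
    have p: "of_nat (k + 1) powr (1 - complex_of_real x) = of_real (p k)" for k
      using of_nat_Suc_powr_real[of k "1 - x"] by (simp only: p_def of_real_diff of_real_1)
    have q: "of_nat (n + 1) powr (- complex_of_real x) = of_real (real (n + 1) powr (- x))"
      using of_nat_Suc_powr_real[of n "- x"] by (simp only: of_real_minus)
    have "n + 2 = (n + 1) + 1" by simp
    then show ?thesis
      unfolding zeta_term_1 t_def by (simp only: p q of_real_diff of_real_mult of_real_1)
  qed
  have mvt: "p (n + 1) - p n \<ge> (1 - x) * real (n + 2) powr (- x)" for n
  proof -
    have "\<exists>z>real (n+1). z < real (n+2) \<and>
      real (n+2) powr (1 - x) - real (n+1) powr (1 - x) = (real (n+2) - real (n+1)) * ((1 - x) * z powr (- x))"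
      by (intro MVT2) (auto intro!: derivative_eq_intros)
    then obtain z where z: "z > real (n+1)" "z < real (n+2)"
      "p (n + 1) - p n = (1 - x) * z powr (- x)" by (auto simp: p_def add_ac)
    then show ?thesis using x by (auto intro!: mult_left_mono powr_mono2')
  qed
  \<comment> \<open>Keeping the last increment of \<open>p\<close> in the bound lets it pay for the
    next subtracted term.\<close>
  have ind: "1 + (\<Sum>n<Suc N. t n) \<ge> x + (p (N + 1) - p N)" for N
  proof (induction N)
    case 0 show ?case by (simp add: t_def p_def)
  next
    case (Suc N)
    then show ?case using mvt[of N] by (simp add: t_def)
  qed
  have part: "1 + (\<Sum>n<Suc N. t n) \<ge> x" for N
  proof -
    have "p (N + 1) \<ge> p N" unfolding p_def using x by (intro powr_mono2) auto
    then show ?thesis using ind[of N] by linarith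
  qed
  have "summable (\<lambda>n. zeta_term 1 n (of_real x))" by (rule summable_zeta_term) (use x in simp)
  then have "(\<lambda>n. complex_of_real (t n)) sums (\<Sum>n. zeta_term 1 n (of_real x))"
    unfolding tz[symmetric] by (rule summable_sums)
  then have "t sums Re (\<Sum>n. zeta_term 1 n (of_real x))"
    by (auto dest: sums_Re)
  then have "(\<lambda>N. \<Sum>n<Suc N. t n) \<longlonglongrightarrow> Re (\<Sum>n. zeta_term 1 n (of_real x))"
    unfolding sums_def by (rule LIMSEQ_Suc)
  then have "(\<lambda>N. 1 + (\<Sum>n<Suc N. t n)) \<longlonglongrightarrow> 1 + Re (\<Sum>n. zeta_term 1 n (of_real x))"
    by (intro tendsto_intros)
  then have "x \<le> 1 + Re (\<Sum>n. zeta_term 1 n (of_real x))"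
    using part by (intro LIMSEQ_le_const) auto
  also have "\<dots> = Re (zeta_reg (of_real x))" using x by (simp add: zeta_reg_eq)
  finally show ?thesis using x by auto
qed

section \<open>Poisson's formula and Jensen's inequality\<close>

lemma circlepath_0_1: "circlepath 0 1 t = cis (2 * pi * t)"
  by (simp add: circlepath_def part_circlepath_def linepath_def cis_conv_exp mult_ac)

text \<open>Cauchy's formula at \<open>x\<close> for \<open>g (r w)\<close> times the auxiliary
  factor \<open>(1 - x\<^sup>2) / (1 - x w)\<close>. The factor equals 1 at \<open>w = x\<close>,
  and on the circle it turns the Cauchy kernel into the Poisson kernel.\<close>

lemma poisson_formula_disc:
  fixes g :: "complex \<Rightarrow> complex" and r R x :: real
  assumes g: "g holomorphic_on ball 0 R" and r: "0 < r" "r < R" and x: "0 \<le> x" "x < 1"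
  shows "((\<lambda>t. (1 - x\<^sup>2) / (cmod (cis (2 * pi * t) - of_real x))\<^sup>2 * Re (g (of_real r * cis (2 * pi * t))))
           has_integral Re (g (of_real (r * x)))) {0..1}"
proof -
  define f where "f = (\<lambda>w. g (of_real r * w) * of_real (1 - x\<^sup>2) / (1 - of_real x * w))"
  have nz: "1 - of_real x * w \<noteq> 0" if "cmod w \<le> 1" for w
  proof
    assume "1 - of_real x * w = 0"
    then have "cmod (of_real x * w) = 1"
      by (metis norm_one eq_iff_diff_eq_0)
    then show False using that x
      by (simp add: norm_mult) (metis less_eq_real_def linorder_not_le mult_left_le order_le_less_trans)
  qed
  have "f holomorphic_on cball 0 1"
    unfolding f_def
  proof (intro holomorphic_intros)
    have "(g \<circ> (\<lambda>w. of_real r * w)) holomorphic_on cball 0 1"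
    proof (rule holomorphic_on_compose_gen[OF _ g])
      show "(\<lambda>w. of_real r * w) ` cball 0 1 \<subseteq> ball (0::complex) R"
      proof (rule image_subsetI)
        fix w :: complex assume "w \<in> cball 0 1"
        then have "r * cmod w \<le> r * 1" using r by (intro mult_left_mono) auto
        with r have "r * cmod w < R" by linarith
        then show "of_real r * w \<in> ball 0 R" using r by (simp add: norm_mult)
      qed
    qed (intro holomorphic_intros)
    then show "(\<lambda>w. g (of_real r * w)) holomorphic_on cball 0 1" by (simp add: o_def)
  qed (use nz in auto)
  then have "((\<lambda>u. f u / (u - of_real x)) has_contour_integral 2 * of_real pi * \<i> * f (of_real x)) (circlepath 0 1)"
    by (rule Cauchy_integral_circlepath_simple) (use x in auto)
  then have "((\<lambda>t. f (cis (2*pi*t)) / (cis (2*pi*t) - of_real x) * (2 * of_real pi * \<i> * cis (2*pi*t)))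
        has_integral 2 * of_real pi * \<i> * f (of_real x)) {0..1}"
    by (simp add: has_contour_integral circlepath_0_1 vector_derivative_circlepath cis_conv_exp mult_ac)
  from has_integral_mult_right[OF this, of "1 / (2 * of_real pi * \<i>)"]
  have *: "((\<lambda>t. f (cis (2*pi*t)) / (cis (2*pi*t) - of_real x) * cis (2*pi*t)) has_integral f (of_real x)) {0..1}"
    by (simp add: field_simps)
  have "f (of_real x) = g (of_real (r * x))"
    using nz[of "of_real x"] x by (simp add: f_def power2_eq_square)
  moreover have "f w / (w - of_real x) * w
      = of_real ((1 - x\<^sup>2) / (cmod (w - of_real x))\<^sup>2) * g (of_real r * w)"
    if "w = cis (2*pi*t)" for w t
  proof -
    have w: "w * cnj w = 1" "cmod w = 1" by (simp_all add: that complex_norm_square[symmetric] flip: cis_cnj)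
    then have wx: "w - of_real x \<noteq> 0" using x by auto
    \<comment> \<open>From \<open>w * cnj w = 1\<close>: the two denominators combine to a squared
      modulus.\<close>
    have "1 - of_real x * w = w * cnj (w - of_real x)" using w by (simp add: algebra_simps)
    moreover have "(complex_of_real (cmod (w - of_real x)))\<^sup>2 = cnj (w - of_real x) * (w - of_real x)"
      by (metis complex_norm_square of_real_power mult.commute)
    ultimately show ?thesis using wx w nz[of w] unfolding f_def
      by (simp add: divide_simps del: complex_cnj_diff)
  qed
  ultimately have "((\<lambda>t. of_real ((1 - x\<^sup>2) / (cmod (cis (2*pi*t) - of_real x))\<^sup>2) * g (of_real r * cis (2*pi*t)))
       has_integral g (of_real (r * x))) {0..1}"
    using * by (auto elim!: has_integral_eq[rotated])
  from has_integral_linear[OF this bounded_linear_Re] show ?thesis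
    unfolding o_def by (simp del: of_real_divide of_real_diff of_real_power of_real_mult)
qed

corollary mean_value_disc:
  fixes g :: "complex \<Rightarrow> complex" and r R :: real
  assumes "g holomorphic_on ball 0 R" and "0 < r" "r < R"
  shows "((\<lambda>t. Re (g (of_real r * cis (2 * pi * t)))) has_integral Re (g 0)) {0..1}"
  using poisson_formula_disc[OF assms, of 0] by simp

section \<open>Jensen's inequality by successive removal of zeros\<close>

text \<open>With \<open>n\<close> the multiplicity of \<open>\<rho>\<close>, divide by
  \<open>(w - \<rho>) ^ n\<close> and multiply by \<open>B w ^ n\<close>. Here \<open>B\<close> has
  no zero in the disc and the modulus of \<open>w - \<rho>\<close> on the circle. At the origin this
  gains the \<open>n\<close>-th power of \<open>r / cmod \<rho> > 1\<close>, of which a single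
  factor is recorded.\<close>

lemma blaschke_remove_zero:
  fixes G :: "complex \<Rightarrow> complex" and r R :: real
  assumes G: "G holomorphic_on ball 0 R" and r: "0 < r" "r < R" and G0: "G 0 \<noteq> 0"
    and \<rho>: "cmod \<rho> < r" "G \<rho> = 0"
  obtains H where "H holomorphic_on ball 0 R"
    and "\<And>w. cmod w = r \<Longrightarrow> cmod (H w) = cmod (G w)"
    and "{w \<in> ball 0 r. H w = 0} = {w \<in> ball 0 r. G w = 0} - {\<rho>}"
    and "cmod (H 0) \<ge> cmod (G 0) * (r / cmod \<rho>)"
proof -
  have \<rho>0: "\<rho> \<noteq> 0" using G0 \<rho> by auto
  have "\<not> G constant_on ball 0 R"
    using \<rho> G0 r unfolding constant_on_def by force
  moreover have "\<rho> \<in> ball 0 R" using \<rho> r by simp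
  ultimately obtain g e n where n: "0 < n" and e: "0 < e" "ball \<rho> e \<subseteq> ball 0 R"
    and g: "g holomorphic_on ball \<rho> e"
    and Gg: "\<And>w. w \<in> ball \<rho> e \<Longrightarrow> G w = (w - \<rho>)^n * g w"
    and gnz: "\<And>w. w \<in> ball \<rho> e \<Longrightarrow> g w \<noteq> 0"
    using holomorphic_factor_zero_nonconstant[OF G open_ball connected_ball _ \<rho>(2)] by metis
  define h where "h = (\<lambda>w. if w = \<rho> then g \<rho> else G w / (w - \<rho>)^n)"
  have h1: "h holomorphic_on ball \<rho> e"
    using g by (rule holomorphic_transform) (auto simp: h_def Gg)
  have "(\<lambda>w. G w / (w - \<rho>)^n) holomorphic_on (ball 0 R - {\<rho>})"
    by (intro holomorphic_intros holomorphic_on_subset[OF G]) auto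
  then have h2: "h holomorphic_on (ball 0 R - {\<rho>})"
    by (rule holomorphic_transform) (auto simp: h_def)
  have "ball \<rho> e \<union> (ball 0 R - {\<rho>}) = ball 0 R"
    using e \<rho> r by auto
  then have h: "h holomorphic_on ball 0 R"
    using holomorphic_on_Un[OF h1 h2] by (simp add: open_delete)
  define B where "B = (\<lambda>w. (of_real (r\<^sup>2) - cnj \<rho> * w) / of_real r)"
  have Bnz: "B w \<noteq> 0" if "cmod w < r" for w
  proof
    assume "B w = 0"
    then have "cmod (cnj \<rho> * w) = cmod (of_real (r\<^sup>2))" using r by (simp add: B_def)
    then have "cmod \<rho> * cmod w = r * r" by (simp add: norm_mult norm_power power2_eq_square)
    moreover have "cmod \<rho> * cmod w < r * r" using that \<rho> by (intro mult_strict_mono') auto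
    ultimately show False by simp
  qed
  have Bs: "cmod (B w) = cmod (w - \<rho>)" if "cmod w = r" for w
  proof -
    have "of_real (r\<^sup>2) - cnj \<rho> * w = w * cnj (w - \<rho>)"
      using that complex_norm_square[of w] by (simp add: algebra_simps)
    then show ?thesis using r that by (simp add: B_def norm_mult norm_divide del: complex_cnj_diff)
  qed
  show thesis
  proof
    show "(\<lambda>w. h w * B w ^ n) holomorphic_on ball 0 R"
      unfolding B_def using r by (intro holomorphic_intros h) auto
    show "cmod (h w * B w ^ n) = cmod (G w)" if "cmod w = r" for w
      using that \<rho> by (auto simp: h_def Bs norm_mult norm_power norm_divide)
    show "{w \<in> ball 0 r. h w * B w ^ n = 0} = {w \<in> ball 0 r. G w = 0} - {\<rho>}"
      using Bnz gnz[of \<rho>] e by (auto simp: h_def n)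
    have "r / cmod \<rho> \<le> (r / cmod \<rho>) ^ n"
      using n \<rho> \<rho>0 by (intro self_le_power) auto
    then have "cmod (G 0) * (r / cmod \<rho>) \<le> cmod (G 0) * (r / cmod \<rho>)^n"
      by (intro mult_left_mono) auto
    also have "\<dots> = cmod (h 0 * B 0 ^ n)"
      using \<rho>0 r by (simp add: h_def B_def norm_mult norm_divide norm_power power_divide power2_eq_square)
    finally show "cmod (h 0 * B 0 ^ n) \<ge> cmod (G 0) * (r / cmod \<rho>)" .
  qed
qed

text \<open>Induction over the zero set in the open disc. Removing a zero keeps the circle values
  and does not decrease the modulus at 0; without zeros, the mean value property of a holomorphic
  logarithm applies.\<close>

lemma jensen_inequality:
  fixes G :: "complex \<Rightarrow> complex" and r R :: real
  assumes "G holomorphic_on ball 0 R" and r: "0 < r" "r < R" and "G 0 \<noteq> 0"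
    and "\<And>w. cmod w = r \<Longrightarrow> G w \<noteq> 0"
  shows "ln (cmod (G 0)) \<le> integral {0..1} (\<lambda>t. ln (cmod (G (of_real r * cis (2 * pi * t)))))"
proof -
  have "\<not> G constant_on ball 0 R \<or> (\<forall>w\<in>ball 0 R. G w \<noteq> 0)"
    using assms(4) r unfolding constant_on_def by force
  then have "finite {w \<in> cball 0 r. G w = 0}"
  proof
    assume "\<not> G constant_on ball 0 R"
    then show ?thesis using r
      by (intro holomorphic_compact_finite_zeros[OF assms(1)]) auto
  next
    assume "\<forall>w\<in>ball 0 R. G w \<noteq> 0"
    then have "{w \<in> cball 0 r. G w = 0} = {}" using r by auto
    then show ?thesis by (metis finite.emptyI)
  qed
  then have "finite {w \<in> ball 0 r. G w = 0}"
    by (rule finite_subset[rotated]) auto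
  from this assms(1,4,5) show ?thesis
  proof (induction "{w \<in> ball 0 r. G w = 0}" arbitrary: G rule: finite_psubset_induct)
    case psubset
    show ?case
    proof (cases "{w \<in> ball 0 r. G w = 0} = {}")
      case True
      have "open {w \<in> ball 0 R. G w \<noteq> 0}"
        using continuous_open_preimage[OF holomorphic_on_imp_continuous_on[OF psubset.prems(1)], of "-{0}"]
        by (simp add: vimage_def Int_def Collect_conj_eq[symmetric] conj_commute open_Compl)
      moreover have "cball 0 r \<subseteq> {w \<in> ball 0 R. G w \<noteq> 0}"
        using True psubset.prems(3) r by (force simp: less_le)
      \<comment> \<open>Compactness of the closed disc leaves a margin \<open>e\<close>, so
        \<open>G\<close> is zero-free on a strictly larger disc and has a holomorphic logarithm
        there.\<close>
      ultimately obtain e where e: "e > 0" "(\<Union>x\<in>cball 0 r. ball x e) \<subseteq> {w \<in> ball 0 R. G w \<noteq> 0}"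
        using compact_subset_open_imp_ball_epsilon_subset[of "cball 0 r" "{w \<in> ball 0 R. G w \<noteq> 0}"] by auto
      have "ball (0::complex) (r + e) \<subseteq> (\<Union>x\<in>cball 0 r. ball x e)"
      proof
        fix w :: complex assume w: "w \<in> ball 0 (r + e)"
        show "w \<in> (\<Union>x\<in>cball 0 r. ball x e)"
        proof (cases "cmod w \<le> r")
          case True then show ?thesis using e by (auto intro!: bexI[of _ w])
        next
          case False
          \<comment> \<open>The radial projection of \<open>w\<close> to the circle of radius
            \<open>r\<close> is the centre of a ball of radius \<open>e\<close> containing
            \<open>w\<close>.\<close>
          have "w - of_real (r / cmod w) * w = of_real (1 - r / cmod w) * w" by (simp add: algebra_simps)
          then have "cmod (w - of_real (r / cmod w) * w) = \<bar>1 - r / cmod w\<bar> * cmod w"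
            by (simp only: norm_mult norm_of_real)
          also have "\<dots> = cmod w - r" using False r by (auto simp: abs_if field_simps)
          finally show ?thesis using False w r
            by (intro UN_I[of "of_real (r / cmod w) * w"]) (auto simp: norm_mult norm_divide dist_norm norm_minus_commute)
        qed
      qed
      with e have sub: "ball 0 (r + e) \<subseteq> {w \<in> ball 0 R. G w \<noteq> 0}" by blast
      then have "G holomorphic_on ball 0 (r + e)"
        by (intro holomorphic_on_subset[OF psubset.prems(1)]) auto
      moreover have "G w \<noteq> 0" if "w \<in> ball 0 (r + e)" for w using sub that by auto
      ultimately obtain g where g: "g holomorphic_on ball 0 (r + e)"
          and eg: "\<And>w. w \<in> ball 0 (r + e) \<Longrightarrow> exp (g w) = G w"
        using holomorphic_logarithm_exists[of "ball 0 (r+e)" G 0] r e by auto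
      have lnG: "ln (cmod (G w)) = Re (g w)" if "w \<in> ball 0 (r + e)" for w
        using eg[OF that, symmetric] by simp
      have "((\<lambda>t. Re (g (of_real r * cis (2 * pi * t)))) has_integral Re (g 0)) {0..1}"
        using mean_value_disc[OF g r(1)] e by simp
      then have "((\<lambda>t. ln (cmod (G (of_real r * cis (2 * pi * t))))) has_integral ln (cmod (G 0))) {0..1}"
        using lnG r e by (simp add: norm_mult)
      then show ?thesis by (simp add: integral_unique)
    next
      case False
      then obtain \<rho> where \<rho>: "cmod \<rho> < r" "G \<rho> = 0" by auto
      obtain H where H: "H holomorphic_on ball 0 R"
        and Hs: "\<And>w. cmod w = r \<Longrightarrow> cmod (H w) = cmod (G w)"
        and Hz: "{w \<in> ball 0 r. H w = 0} = {w \<in> ball 0 r. G w = 0} - {\<rho>}"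
        and H0: "cmod (H 0) \<ge> cmod (G 0) * (r / cmod \<rho>)"
        by (rule blaschke_remove_zero[OF psubset.prems(1) r psubset.prems(2) \<rho>]) (rule that)
      have \<rho>0: "\<rho> \<noteq> 0" using psubset.prems \<rho> by auto
      have "cmod (G 0) * 1 \<le> cmod (G 0) * (r / cmod \<rho>)"
        using \<rho> \<rho>0 by (intro mult_left_mono) auto
      with H0 have le: "cmod (G 0) \<le> cmod (H 0)" by simp
      have "ln (cmod (G 0)) \<le> ln (cmod (H 0))"
        using le psubset.prems(2) by (intro ln_mono) auto
      also have "\<dots> \<le> integral {0..1} (\<lambda>t. ln (cmod (H (of_real r * cis (2 * pi * t)))))"
      proof (rule psubset.hyps(2)[OF _ H])
        show "{w \<in> ball 0 r. H w = 0} \<subset> {w \<in> ball 0 r. G w = 0}"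
          using Hz \<rho> by auto
        show "H 0 \<noteq> 0" using le psubset.prems(2) by auto
        show "H w \<noteq> 0" if "cmod w = r" for w
          using Hs[OF that] psubset.prems(3)[OF that] by auto
      qed
      also have "\<dots> = integral {0..1} (\<lambda>t. ln (cmod (G (of_real r * cis (2 * pi * t)))))"
        using r by (simp add: Hs norm_mult)
      finally show ?thesis .
    qed
  qed
qed

text \<open>One zero is removed by hand, so that its gain \<open>ln (r / cmod \<rho>)\<close> is
  kept; this makes the boundary inequality strict later.\<close>

lemma jensen_inequality_zero:
  fixes G :: "complex \<Rightarrow> complex" and r R :: real
  assumes G: "G holomorphic_on ball 0 R" and r: "0 < r" "r < R" and G0: "G 0 \<noteq> 0"
    and nz: "\<And>w. cmod w = r \<Longrightarrow> G w \<noteq> 0"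
    and \<rho>: "cmod \<rho> < r" "G \<rho> = 0"
  shows "ln (cmod (G 0)) + ln (r / cmod \<rho>) \<le> integral {0..1} (\<lambda>t. ln (cmod (G (of_real r * cis (2 * pi * t)))))"
proof -
  obtain H where H: "H holomorphic_on ball 0 R"
    and Hs: "\<And>w. cmod w = r \<Longrightarrow> cmod (H w) = cmod (G w)"
    and H0: "cmod (H 0) \<ge> cmod (G 0) * (r / cmod \<rho>)"
    using blaschke_remove_zero[OF G r G0 \<rho>] by metis
  have \<rho>0: "\<rho> \<noteq> 0" using G0 \<rho> by auto
  have pos: "cmod (G 0) * (r / cmod \<rho>) > 0" using G0 r \<rho>0 by simp
  then have "ln (cmod (G 0)) + ln (r / cmod \<rho>) \<le> ln (cmod (H 0))"
    using H0 G0 r \<rho>0 by (metis divide_pos_pos ln_mono ln_mult_pos zero_less_norm_iff)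
  also have "\<dots> \<le> integral {0..1} (\<lambda>t. ln (cmod (H (of_real r * cis (2 * pi * t)))))"
    using pos H0 Hs nz by (intro jensen_inequality[OF H r]) force+
  also have "\<dots> = integral {0..1} (\<lambda>t. ln (cmod (G (of_real r * cis (2 * pi * t)))))"
    using r by (simp add: Hs norm_mult)
  finally show ?thesis .
qed


section \<open>Boundary means of bounded functions in the disc\<close>

text \<open>Fatou's lemma for the Lebesgue integral, carried over to the gauge integral. Convergence
  may fail where \<open>g x = 0\<close>, since the liminf of nonnegative values is at least 0 there
  anyway; integrability of \<open>g\<close> is part of the conclusion.\<close>

lemma fatou_integral:
  fixes f :: "nat \<Rightarrow> real \<Rightarrow> real"
  assumes fm: "\<And>n. (\<lambda>x. indicator S x * f n x) \<in> borel_measurable borel"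
    and gm: "(\<lambda>x. indicator S x * g x) \<in> borel_measurable borel"
    and f0: "\<And>n x. x \<in> S \<Longrightarrow> 0 \<le> f n x" and g0: "\<And>x. x \<in> S \<Longrightarrow> 0 \<le> g x"
    and lim: "\<And>x. x \<in> S \<Longrightarrow> g x = 0 \<or> (\<lambda>n. f n x) \<longlonglongrightarrow> g x"
    and I: "\<And>n. (f n has_integral I n) S" and le: "\<And>n. I n \<le> c n" and c: "c \<longlonglongrightarrow> C"
  shows "g integrable_on S" and "integral S g \<le> C"
proof -
  have I0: "0 \<le> I n" for n using has_integral_nonneg[OF I] f0 by blast
  have "0 \<le> c n" for n using I0[of n] le[of n] by simp
  then have C0: "0 \<le> C" using c by (intro LIMSEQ_le_const) auto
  have "(\<integral>\<^sup>+x. ennreal (indicator S x * g x) \<partial>lborel)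
      \<le> (\<integral>\<^sup>+x. liminf (\<lambda>n. ennreal (indicator S x * f n x)) \<partial>lborel)"
  proof (rule nn_integral_mono)
    fix x
    show "ennreal (indicator S x * g x) \<le> liminf (\<lambda>n. ennreal (indicator S x * f n x))"
    proof (cases "x \<in> S \<and> g x \<noteq> 0")
      case True
      then have "(\<lambda>n. ennreal (indicator S x * f n x)) \<longlonglongrightarrow> ennreal (indicator S x * g x)"
        using lim[of x] by (intro tendsto_ennrealI) auto
      then show ?thesis by (simp add: lim_imp_Liminf)
    next
      case False then show ?thesis by (auto simp: indicator_def)
    qed
  qed
  also have "\<dots> \<le> liminf (\<lambda>n. \<integral>\<^sup>+x. ennreal (indicator S x * f n x) \<partial>lborel)"
    using fm by (intro nn_integral_liminf) auto
  also have "\<dots> = liminf (\<lambda>n. ennreal (I n))"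
    using nn_integral_has_integral_lebesgue[OF f0 I] by simp
  also have "\<dots> \<le> liminf (\<lambda>n. ennreal (c n))"
    using le by (intro Liminf_mono always_eventually allI ennreal_leI) auto
  also have "\<dots> = ennreal C"
    using c by (intro lim_imp_Liminf tendsto_ennrealI) auto
  finally have bd: "(\<integral>\<^sup>+x. ennreal (indicator S x * g x) \<partial>lborel) \<le> ennreal C" .
  then obtain r where r: "(\<integral>\<^sup>+x. ennreal (indicator S x * g x) \<partial>lborel) = ennreal r" "0 \<le> r"
    by (cases "\<integral>\<^sup>+x. ennreal (indicator S x * g x) \<partial>lborel" rule: ennreal_cases) (auto simp: top_unique)
  have "((\<lambda>x. indicator S x * g x) has_integral r) UNIV"
    using gm g0 r by (intro nn_integral_has_integral) (auto simp: indicator_def)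
  moreover have "(\<lambda>x. indicator S x * g x) = (\<lambda>x. if x \<in> S then g x else 0)"
    by (auto simp: indicator_def)
  ultimately have "(g has_integral r) S"
    by (simp add: has_integral_restrict_UNIV)
  moreover have "r \<le> C" using bd r C0 by simp
  ultimately show "g integrable_on S" "integral S g \<le> C" by (auto simp: integral_unique)
qed

section \<open>Elementary geometry of the unit circle\<close>

lemma cis_2pi_inj:
  assumes "cis (2 * pi * s) = cis (2 * pi * t)" "\<bar>s - t\<bar> < 1"
  shows "s = t"
proof -
  have e: "exp (\<i> * of_real (2 * pi * s)) = exp (\<i> * of_real (2 * pi * t))"
    using assms by (simp add: cis_conv_exp)
  have "\<bar>Im (\<i> * of_real (2 * pi * s)) - Im (\<i> * of_real (2 * pi * t))\<bar> < 2 * pi"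
    using assms(2) by (simp add: right_diff_distrib[symmetric] abs_mult)
  then have "\<i> * of_real (2 * pi * s) = \<i> * of_real (2 * pi * t)"
    using e by (rule exp_complex_eqI)
  then have "complex_of_real (2 * pi * s) = of_real (2 * pi * t)" by simp
  then have "2 * pi * s = 2 * pi * t" using of_real_eq_iff by blast
  then show ?thesis by simp
qed

lemma cis_2pi_neq_1: "0 < t \<Longrightarrow> t < 1 \<Longrightarrow> cis (2 * pi * t) \<noteq> 1"
  using cis_2pi_inj[of t 0] by auto

lemma norm_cis_minus_1_le: "cmod (cis x - 1) \<le> \<bar>x\<bar>"
  using dist_exp_i_1[of x] abs_sin_x_le_abs_x[of "x/2"] by (simp add: cis_conv_exp)

text \<open>Since \<open>z\<close> lies on the circle, the radial shift \<open>1 - r\<close> is at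
  most the distance from \<open>r w\<close> to \<open>z\<close>. So moving inwards at worst halves
  the distance to a boundary zero.\<close>

lemma radial_dist_ge:
  assumes "cmod w = 1" "cmod z = 1" "0 \<le> r" "r \<le> 1"
  shows "cmod (w - z) \<le> 2 * cmod (of_real r * w - z)"
proof -
  have "cmod (w - of_real r * w) = 1 - r"
    using assms by (metis abs_of_nonneg diff_ge_0_iff_ge left_diff_distrib mult.right_neutral mult_1
        norm_mult norm_of_real of_real_1 of_real_diff)
  moreover have "1 - r \<le> cmod (of_real r * w - z)"
    using norm_triangle_ineq2[of z "of_real r * w"] assms by (simp add: norm_mult norm_minus_commute)
  ultimately show ?thesis
    using norm_triangle_ineq[of "w - of_real r * w" "of_real r * w - z"] by simp
qed

text \<open>The hypothesis \<open>slow\<close> excludes an inner factor with a point mass at \<open>1\<close>, such as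
  \<open>exp (- (1 + w) / (1 - w))\<close>, for which the mean value property fails without any zero.\<close>

locale slow_bounded_disc =
  fixes K :: "complex \<Rightarrow> complex"
  assumes hol: "K holomorphic_on - {1}"
    and bounded: "\<And>w. cmod w \<le> 1 \<Longrightarrow> w \<noteq> 1 \<Longrightarrow> cmod (K w) \<le> 1"
    and K0: "K 0 \<noteq> 0"
    and slow: "((\<lambda>x. (1 - x) * ln (cmod (K (of_real x)))) \<longlongrightarrow> 0) (at_left 1)"
begin

text \<open>The angle is counted in turns, so integrals over an interval of length one are circle
  means; the sign makes the values nonnegative.\<close>

definition L :: "real \<Rightarrow> real \<Rightarrow> real" where
  "L r t = - ln (cmod (K (of_real r * cis (2 * pi * t))))"

lemma hol_ball: "K holomorphic_on ball 0 1"
  by (rule holomorphic_on_subset[OF hol]) auto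

lemma point_neq_1: "0 \<le> r \<Longrightarrow> r \<le> 1 \<Longrightarrow> r < 1 \<or> 0 < t \<and> t < 1 \<Longrightarrow> of_real r * cis (2 * pi * t) \<noteq> 1"
proof
  assume r: "0 \<le> r" "r \<le> 1" "r < 1 \<or> 0 < t \<and> t < 1" and e: "of_real r * cis (2 * pi * t) = 1"
  then have "cmod (of_real r * cis (2 * pi * t)) = 1" by simp
  then have "r = 1" using r by (simp add: norm_mult)
  then show False using r e cis_2pi_neq_1[of t] by simp
qed

lemma L_nonneg:
  assumes "0 \<le> r" "r \<le> 1" "r < 1 \<or> 0 < t \<and> t < 1"
  shows "0 \<le> L r t"
proof -
  have "cmod (K (of_real r * cis (2 * pi * t))) \<le> 1"
    using assms point_neq_1[of r t] by (intro bounded) (auto simp: norm_mult)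
  then show ?thesis
    unfolding L_def by (cases "K (of_real r * cis (2 * pi * t)) = 0") auto
qed

lemma continuous_L:
  assumes "0 < r" "r < 1" "\<And>w. cmod w = r \<Longrightarrow> K w \<noteq> 0"
  shows "continuous_on A (L r)"
proof -
  have "continuous_on A (K \<circ> (\<lambda>t. of_real r * cis (2 * pi * t)))"
    by (intro continuous_on_compose continuous_intros continuous_on_subset[OF holomorphic_on_imp_continuous_on[OF hol]])
      (use point_neq_1[of r] assms in auto)
  then show ?thesis
    unfolding L_def using assms by (intro continuous_intros) (auto simp: o_def norm_mult)
qed

lemma measurable_L:
  assumes "0 \<le> r" "r \<le> 1"
  shows "(\<lambda>t. indicator {0<..<1} t * L r t) \<in> borel_measurable borel"
proof -
  have "continuous_on {0<..<1} (K \<circ> (\<lambda>t. of_real r * cis (2 * pi * t)))"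
    by (intro continuous_on_compose continuous_intros continuous_on_subset[OF holomorphic_on_imp_continuous_on[OF hol]])
      (use point_neq_1[of r] assms in auto)
  then have "(\<lambda>t. indicator {0<..<1} t *\<^sub>R K (of_real r * cis (2 * pi * t))) \<in> borel_measurable borel"
    by (intro borel_measurable_continuous_on_indicator) (auto simp: o_def)
  then have "(\<lambda>t. indicator {0<..<1::real} t * - ln (cmod (indicator {0<..<1} t *\<^sub>R K (of_real r * cis (2 * pi * t))))) \<in> borel_measurable borel"
    by measurable
  moreover have "indicator {0<..<1::real} t * - ln (cmod (indicator {0<..<1} t *\<^sub>R K (of_real r * cis (2 * pi * t))))
     = indicator {0<..<1} t * L r t" for t
    by (auto simp: indicator_def L_def)
  ultimately show ?thesis by (simp only:)
qed

lemma L_tendsto: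
  assumes "r \<longlonglongrightarrow> 1" "0 < t" "t < 1" "K (cis (2 * pi * t)) \<noteq> 0"
  shows "(\<lambda>n. L (r n) t) \<longlonglongrightarrow> L 1 t"
proof -
  have cont: "isCont K (cis (2 * pi * t))"
    using continuous_on_interior[OF holomorphic_on_imp_continuous_on[OF hol]] cis_2pi_neq_1[of t] assms
    by (simp add: interior_open open_Compl)
  have "(\<lambda>n. of_real (r n) * cis (2 * pi * t)) \<longlonglongrightarrow> of_real 1 * cis (2 * pi * t)"
    by (intro tendsto_intros assms)
  then have "(\<lambda>n. K (of_real (r n) * cis (2 * pi * t))) \<longlonglongrightarrow> K (cis (2 * pi * t))"
    using isCont_tendsto_compose[OF cont] by simp
  then show ?thesis
    unfolding L_def using assms by (intro tendsto_intros) auto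
qed

section \<open>Sparsity of zeros, and the upper bound for the boundary mean\<close>

text \<open>The punctured plane is a countable union of closed sets, the complements of shrinking
  balls around 1; a nonconstant holomorphic function has countably many zeros on such a
  domain.\<close>

lemma countable_zeros: "countable {w. w \<noteq> 1 \<and> K w = 0}"
proof (cases "K constant_on (- {1})")
  case True
  then have "{w. w \<noteq> 1 \<and> K w = 0} = {}"
    using K0 unfolding constant_on_def by force
  then show ?thesis by (metis countable_empty)
next
  case False
  have "- {1} = (\<Union>n. - ball (1::complex) (inverse (real (Suc n))))"
  proof (intro equalityI subsetI)
    fix w :: complex assume "w \<in> - {1}"
    then obtain n where "inverse (real (Suc n)) < dist 1 w"
      using reals_Archimedean[of "dist 1 w"] by auto
    then show "w \<in> (\<Union>n. - ball 1 (inverse (real (Suc n))))" by (intro UN_I[of n]) auto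
  qed auto
  moreover have "fsigma (\<Union>n. - ball (1::complex) (inverse (real (Suc n))))"
    by (rule fsigma.intros) (simp add: closed_Compl)
  ultimately have "fsigma (- {1::complex})" by simp
  then have "countable {w \<in> - {1}. K w = 0}"
    using False by (intro holomorphic_countable_zeros[OF hol] connected_punctured_universe) auto
  then show ?thesis by simp
qed

lemma negligible_boundary_zeros: "negligible {t. 0 < t \<and> t < 1 \<and> K (cis (2 * pi * t)) = 0}"
proof -
  have "(\<lambda>t. cis (2 * pi * t)) ` {t. 0 < t \<and> t < 1 \<and> K (cis (2 * pi * t)) = 0} \<subseteq> {w. w \<noteq> 1 \<and> K w = 0}"
    using cis_2pi_neq_1 by auto
  then have "countable ((\<lambda>t. cis (2 * pi * t)) ` {t. 0 < t \<and> t < 1 \<and> K (cis (2 * pi * t)) = 0})"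
    using countable_zeros countable_subset by blast
  moreover have "inj_on (\<lambda>t. cis (2 * pi * t)) {t. 0 < t \<and> t < 1 \<and> K (cis (2 * pi * t)) = 0}"
    by (intro inj_onI cis_2pi_inj) auto
  ultimately have "countable {t. 0 < t \<and> t < 1 \<and> K (cis (2 * pi * t)) = 0}"
    by (rule countable_image_inj_on)
  then show ?thesis
    by (simp add: negligible_iff_null_sets countable_imp_null_set_lborel null_sets_completionI)
qed

text \<open>At a boundary zero the convention \<open>ln 0 = 0\<close> only makes \<open>L 1\<close> smaller, so Fatou's lemma
  needs no exceptional set.\<close>

lemma boundary_integral_le:
  assumes r: "\<And>n. 0 < r n" "\<And>n. r n < 1" "r \<longlonglongrightarrow> 1" and nz: "\<And>n w. cmod w = r n \<Longrightarrow> K w \<noteq> 0"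
    and le: "\<And>n. integral {0..1} (L (r n)) \<le> c n" and c: "c \<longlonglongrightarrow> C"
  shows "L 1 integrable_on {0<..<1}" and "integral {0<..<1} (L 1) \<le> C"
proof -
  have I: "(L (r n) has_integral integral {0..1} (L (r n))) {0<..<1}" for n
    unfolding has_integral_Icc_iff_Ioo[symmetric]
    by (intro integrable_integral integrable_continuous_interval continuous_L r nz)
  have *: "L 1 t = 0 \<or> (\<lambda>n. L (r n) t) \<longlonglongrightarrow> L 1 t" if "t \<in> {0<..<1}" for t
    using L_tendsto[OF r(3), of t] that by (cases "K (cis (2 * pi * t)) = 0") (auto simp: L_def)
  have "L 1 integrable_on {0<..<1} \<and> integral {0<..<1} (L 1) \<le> C"
    using fatou_integral[OF measurable_L measurable_L L_nonneg L_nonneg * I le c] r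
    by (simp add: less_imp_le)
  then show "L 1 integrable_on {0<..<1}" and "integral {0<..<1} (L 1) \<le> C" by auto
qed

text \<open>The moduli of zeros form a countable set, which cannot cover an interval; so radii
  avoiding all zeros can be chosen arbitrarily close to 1.\<close>

lemma good_radii:
  assumes "q < 1"
  obtains r where "\<And>n. 0 < r n" "\<And>n. q < r n" "\<And>n. r n < 1" "r \<longlonglongrightarrow> 1" "\<And>n w. cmod w = r n \<Longrightarrow> K w \<noteq> 0"
proof -
  define l where "l = (\<lambda>n. max (max q 0) (1 - inverse (real (Suc n))))"
  have l: "l n < 1" for n using assms by (auto simp: l_def)
  have "\<exists>r. l n < r \<and> r < 1 \<and> r \<notin> cmod ` {w. w \<noteq> 1 \<and> K w = 0}" for n
  proof (rule ccontr)
    assume "\<not> ?thesis"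
    then have "{l n<..<1} \<subseteq> cmod ` {w. w \<noteq> 1 \<and> K w = 0}" by auto
    then have "countable {l n<..<1}"
      using countable_zeros countable_image countable_subset by blast
    then show False using l[of n] using uncountable_open_interval by blast
  qed
  then obtain r where r: "\<And>n. l n < r n" "\<And>n. r n < 1" "\<And>n. r n \<notin> cmod ` {w. w \<noteq> 1 \<and> K w = 0}"
    by metis
  have "r \<longlonglongrightarrow> 1"
  proof (rule tendsto_sandwich)
    show "(\<lambda>n. 1 - inverse (real (Suc n))) \<longlonglongrightarrow> 1"
      using tendsto_diff[OF tendsto_const LIMSEQ_inverse_real_of_nat, of 1] by simp
    show "\<forall>\<^sub>F n in sequentially. 1 - inverse (real (Suc n)) \<le> r n"
      using r(1) by (intro always_eventually allI) (smt (verit) l_def)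
    show "\<forall>\<^sub>F n in sequentially. r n \<le> 1" using r(2) by (simp add: less_imp_le)
  qed simp
  moreover have "K w \<noteq> 0" if "cmod w = r n" for n w
  proof
    assume "K w = 0"
    moreover have "w \<noteq> 1" using that r(2)[of n] by auto
    ultimately have "cmod w \<in> cmod ` {w. w \<noteq> 1 \<and> K w = 0}" by blast
    then show False using r(3)[of n] that by simp
  qed
  moreover have "0 < r n" "q < r n" for n using r(1)[of n] by (auto simp: l_def)
  ultimately show thesis using r(2) that by metis
qed

lemma integral_L_le:
  assumes "0 < r" "r < 1" "\<And>w. cmod w = r \<Longrightarrow> K w \<noteq> 0"
  shows "integral {0..1} (L r) \<le> - ln (cmod (K 0))"
  using jensen_inequality[OF hol_ball assms(1,2) K0 assms(3)]
  unfolding L_def by simp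

text \<open>Jensen bounds the means over good circles by a constant, and Fatou passes this bound to
  the boundary.\<close>

lemma L_integrable: "L 1 integrable_on {0<..<1}"
  and integral_L_1_le: "integral {0<..<1} (L 1) \<le> - ln (cmod (K 0))"
proof -
  obtain r where r: "\<And>n. 0 < r n" "\<And>n. r n < 1" "r \<longlonglongrightarrow> 1" "\<And>n w. cmod w = r n \<Longrightarrow> K w \<noteq> 0"
    using good_radii[of 0] by (metis zero_less_one)
  note * = boundary_integral_le[OF r integral_L_le[OF r(1,2,4)] tendsto_const]
  show "L 1 integrable_on {0<..<1}" "integral {0<..<1} (L 1) \<le> - ln (cmod (K 0))"
    using * by auto
qed

text \<open>The zero lowers the Jensen bound by \<open>ln (r n / cmod \<rho>)\<close>, which tends
  to a positive limit and therefore survives the passage to the boundary.\<close>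

lemma integral_L_1_less:
  assumes \<rho>: "cmod \<rho> < 1" "K \<rho> = 0"
  shows "integral {0<..<1} (L 1) < - ln (cmod (K 0))"
proof -
  have \<rho>0: "\<rho> \<noteq> 0" using K0 \<rho> by auto
  obtain r where r: "\<And>n. 0 < r n" "\<And>n. cmod \<rho> < r n" "\<And>n. r n < 1" "r \<longlonglongrightarrow> 1" "\<And>n w. cmod w = r n \<Longrightarrow> K w \<noteq> 0"
    using good_radii[OF \<rho>(1)] by metis
  have le: "integral {0..1} (L (r n)) \<le> - ln (cmod (K 0)) - ln (r n / cmod \<rho>)" for n
    using jensen_inequality_zero[OF hol_ball r(1)[of n] r(3)[of n] K0 r(5)[where n = n] r(2)[of n] \<rho>(2)]
    unfolding L_def by simp
  have lim: "(\<lambda>n. - ln (cmod (K 0)) - ln (r n / cmod \<rho>)) \<longlonglongrightarrow> - ln (cmod (K 0)) - ln (1 / cmod \<rho>)"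
    using \<rho>0 by (intro tendsto_intros r) auto
  have "integral {0<..<1} (L 1) \<le> - ln (cmod (K 0)) - ln (1 / cmod \<rho>)"
    by (rule boundary_integral_le(2)[OF r(1,3,4,5) le lim])
  moreover have "ln (1 / cmod \<rho>) > 0" using \<rho> \<rho>0 by simp
  ultimately show ?thesis by linarith
qed

section \<open>The zero-free case: domination away from 1 and control of the mass near 1\<close>

text \<open>After taking logarithms this says that \<open>L r\<close> is at most \<open>L 1\<close>
  plus a constant, as dominated convergence requires. If \<open>K w0\<close> is nonzero it follows
  from continuity and \<open>cmod (K w) \<le> 1\<close>; at a zero the factor
  \<open>(w - w0) ^ n\<close> is handled by \<open>radial_dist_ge\<close>.\<close>

lemma radial_lower_bound_local:
  assumes w0: "cmod w0 = 1" "w0 \<noteq> 1"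
  shows "\<exists>d>0. \<exists>c>0. \<forall>w r. cmod w = 1 \<longrightarrow> dist w0 w < d \<longrightarrow> w \<noteq> 1 \<longrightarrow> 1 - d < r \<longrightarrow> 0 \<le> r \<longrightarrow> r \<le> 1
           \<longrightarrow> c * cmod (K w) \<le> cmod (K (of_real r * w))"
proof -
  have near: "dist w0 (of_real r * w) < 2 * d" if "cmod w = 1" "dist w0 w < d" "1 - d < r" "r \<le> 1" for w r d
  proof -
    have "dist w (of_real r * w) = cmod (of_real (1 - r) * w)"
      by (simp add: dist_norm left_diff_distrib)
    also have "\<dots> = 1 - r" using that by (simp only: norm_mult norm_of_real) simp
    finally show ?thesis using that dist_triangle[of w0 "of_real r * w" w] by linarith
  qed
  show ?thesis
  proof (cases "K w0 = 0")
    case False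
    have "isCont K w0"
      using continuous_on_interior[OF holomorphic_on_imp_continuous_on[OF hol]] w0
      by (simp add: interior_open open_Compl)
    then obtain d where d: "d > 0" "\<And>w. dist w w0 < d \<Longrightarrow> dist (K w) (K w0) < cmod (K w0) / 2"
      using False unfolding continuous_at_eps_delta by (metis half_gt_zero zero_less_norm_iff)
    have "cmod (K w0) / 2 * cmod (K w) \<le> cmod (K (of_real r * w))"
      if w: "cmod w = 1" "dist w0 w < d / 2" "w \<noteq> 1" "1 - d / 2 < r" "0 \<le> r" "r \<le> 1" for w r
    proof -
      have "dist (K (of_real r * w)) (K w0) < cmod (K w0) / 2"
        using near[OF w(1,2,4,6)] by (intro d) (simp add: dist_commute)
      then have "cmod (K w0) / 2 \<le> cmod (K (of_real r * w))"
        using norm_triangle_ineq2[of "K w0" "K (of_real r * w)"] by (simp add: dist_norm norm_minus_commute)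
      moreover have "cmod (K w0) / 2 * cmod (K w) \<le> cmod (K w0) / 2 * 1"
        using w by (intro mult_left_mono bounded) auto
      ultimately show ?thesis by linarith
    qed
    then show ?thesis using d(1) False
      by (intro exI[of _ "d / 2"] conjI exI[of _ "cmod (K w0) / 2"]) auto
  next
    case True
    have nc: "\<not> K constant_on (- {1})"
      using True K0 w0 unfolding constant_on_def by force
    have "connected (- {1::complex})" by (intro connected_punctured_universe) simp
    then obtain g e n where n: "0 < n" and e: "0 < e"
      and g: "g holomorphic_on ball w0 e"
      and Kg: "\<And>w. w \<in> ball w0 e \<Longrightarrow> K w = (w - w0)^n * g w"
      and gnz: "\<And>w. w \<in> ball w0 e \<Longrightarrow> g w \<noteq> 0"
      using holomorphic_factor_zero_nonconstant[OF hol _ _ _ True nc] w0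
      by (metis ComplI closed_singleton open_Compl singletonD)
    define m where "m = cmod (g w0)"
    have m: "m > 0" using gnz[of w0] e by (simp add: m_def)
    have "isCont g w0"
      using continuous_on_interior[OF holomorphic_on_imp_continuous_on[OF g]] e by simp
    then obtain d where d: "d > 0" "\<And>w. dist w w0 < d \<Longrightarrow> dist (g w) (g w0) < m / 2"
      using m unfolding continuous_at_eps_delta by (metis half_gt_zero)
    define d' where "d' = min d e / 2"
    have d': "d' > 0" "2 * d' \<le> d" "2 * d' \<le> e" using d e by (auto simp: d'_def)
    have gb: "m / 2 \<le> cmod (g w)" "cmod (g w) \<le> 2 * m" if "dist w0 w < d" for w
    proof -
      have "dist (g w) (g w0) < m / 2" using d(2)[of w] that by (simp add: dist_commute)
      then show "m / 2 \<le> cmod (g w)" "cmod (g w) \<le> 2 * m"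
        using norm_triangle_ineq2[of "g w0" "g w"] norm_triangle_ineq2[of "g w" "g w0"] m
        by (simp_all add: dist_norm norm_minus_commute m_def)
    qed
    \<comment> \<open>The power of 1/2 comes from \<open>radial_dist_ge\<close>; the quarter is the
      ratio of the bounds \<open>m / 2\<close> and \<open>2 * m\<close> for \<open>g\<close> near
      \<open>w0\<close>.\<close>
    have "(1/2)^n / 4 * cmod (K w) \<le> cmod (K (of_real r * w))"
      if w: "cmod w = 1" "dist w0 w < d'" "w \<noteq> 1" "1 - d' < r" "0 \<le> r" "r \<le> 1" for w r
    proof -
      have nr: "dist w0 (of_real r * w) < 2 * d'" using near w by blast
      have nw: "dist w0 w < 2 * d'" using w d' by linarith
      have "(1/2)^n / 4 * cmod (K w) = (1/2 * cmod (w - w0))^n * (cmod (g w) / 4)"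
        using Kg[of w] nw d' by (simp add: norm_mult norm_power power_mult_distrib power_divide)
      also have "\<dots> \<le> (cmod (of_real r * w - w0))^n * (m / 2)"
        using radial_dist_ge[OF w(1) w0(1) w(5,6)] gb(2)[of w] nw d' m
        by (intro mult_mono power_mono) auto
      also have "\<dots> \<le> (cmod (of_real r * w - w0))^n * cmod (g (of_real r * w))"
        using gb(1)[of "of_real r * w"] nr d' by (intro mult_left_mono) auto
      also have "\<dots> = cmod (K (of_real r * w))"
        using Kg[of "of_real r * w"] nr d' by (simp add: norm_mult norm_power)
      finally show ?thesis .
    qed
    then show ?thesis using d'(1)
      by (intro exI[of _ d'] conjI exI[of _ "(1/2)^n / 4"]) auto
  qed
qed

text \<open>The arc is compact and avoids 1, so finitely many local bounds suffice.\<close>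

lemma radial_lower_bound:
  assumes e: "0 < e"
  obtains d c where "0 < d" "0 < c"
    "\<And>t r. t \<in> {e..1-e} \<Longrightarrow> 1 - d < r \<Longrightarrow> 0 \<le> r \<Longrightarrow> r \<le> 1
       \<Longrightarrow> c * cmod (K (cis (2 * pi * t))) \<le> cmod (K (of_real r * cis (2 * pi * t)))"
proof -
  define A where "A = (\<lambda>t. cis (2 * pi * t)) ` {e..1-e}"
  have A1: "cmod w = 1 \<and> w \<noteq> 1" if "w \<in> A" for w
    using that e cis_2pi_neq_1 by (auto simp: A_def)
  have "compact A" unfolding A_def
    by (intro compact_continuous_image continuous_intros) auto
  have "\<forall>w0\<in>A. \<exists>d c. d > 0 \<and> c > 0 \<and> (\<forall>w r. cmod w = 1 \<longrightarrow> dist w0 w < d \<longrightarrow> w \<noteq> 1 \<longrightarrow> 1 - d < r \<longrightarrow> 0 \<le> r \<longrightarrow> r \<le> 1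
           \<longrightarrow> c * cmod (K w) \<le> cmod (K (of_real r * w)))"
    using radial_lower_bound_local A1 by blast
  then obtain D C where D: "\<And>w0. w0 \<in> A \<Longrightarrow> D w0 > 0" and C: "\<And>w0. w0 \<in> A \<Longrightarrow> C w0 > 0"
    and DC: "\<And>w0 w r. w0 \<in> A \<Longrightarrow> cmod w = 1 \<Longrightarrow> dist w0 w < D w0 \<Longrightarrow> w \<noteq> 1 \<Longrightarrow> 1 - D w0 < r \<Longrightarrow> 0 \<le> r \<Longrightarrow> r \<le> 1
           \<Longrightarrow> C w0 * cmod (K w) \<le> cmod (K (of_real r * w))"
    unfolding bchoice_iff by blast
  have "A \<subseteq> (\<Union>w0\<in>A. ball w0 (D w0))" using D by auto
  then obtain B where B: "B \<subseteq> A" "finite B" "A \<subseteq> (\<Union>w0\<in>B. ball w0 (D w0))"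
    using compactE_image[OF \<open>compact A\<close>, of A "\<lambda>w0. ball w0 (D w0)"] by auto
  \<comment> \<open>Inserting 1 keeps \<open>Min\<close> meaningful for an empty cover, which occurs
    when \<open>e > 1/2\<close> makes the arc empty.\<close>
  define d where "d = Min (insert 1 (D ` B))"
  define c where "c = Min (insert 1 (C ` B))"
  show thesis
  proof
    show "0 < d" "0 < c" using B D C by (auto simp: d_def c_def)
    fix t r assume t: "t \<in> {e..1-e}" and r: "1 - d < r" "0 \<le> r" "r \<le> 1"
    define w where "w = cis (2 * pi * t)"
    have wA: "w \<in> A" using t by (auto simp: A_def w_def)
    then obtain w0 where w0: "w0 \<in> B" "dist w0 w < D w0" using B by auto
    have "d \<le> D w0" "c \<le> C w0" using B w0 by (auto simp: d_def c_def)
    then have "c * cmod (K w) \<le> C w0 * cmod (K w)" by (intro mult_right_mono) auto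
    also have "\<dots> \<le> cmod (K (of_real r * w))"
      using w0 B A1[OF wA] r \<open>d \<le> D w0\<close> by (intro DC) auto
    finally show "c * cmod (K (cis (2 * pi * t))) \<le> cmod (K (of_real r * cis (2 * pi * t)))"
      by (simp add: w_def)
  qed
qed

lemma L_integrable_arc: "0 < e \<Longrightarrow> L 1 integrable_on {e..1-e}"
  using L_integrable integrable_subinterval_real[of "L 1" 0 1 e "1 - e"]
  by (simp add: integrable_on_Icc_iff_Ioo)

text \<open>Dominated convergence with majorant \<open>L 1 - ln c\<close>. Zeros on the boundary
  circle are still possible, so the null set \<open>Z\<close> is cut out first.\<close>

lemma integral_arc_tendsto:
  assumes nz: "\<And>w. cmod w < 1 \<Longrightarrow> K w \<noteq> 0" and e: "0 < e"
    and r: "\<And>n. 0 < r n" "\<And>n. r n < 1" "r \<longlonglongrightarrow> 1"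
  shows "(\<lambda>n. integral {e..1-e} (L (r n))) \<longlonglongrightarrow> integral {e..1-e} (L 1)"
proof -
  obtain d c where d: "0 < d" and c: "0 < c"
    and dc: "\<And>t r. t \<in> {e..1-e} \<Longrightarrow> 1 - d < r \<Longrightarrow> 0 \<le> r \<Longrightarrow> r \<le> 1
       \<Longrightarrow> c * cmod (K (cis (2 * pi * t))) \<le> cmod (K (of_real r * cis (2 * pi * t)))"
    by (rule radial_lower_bound[OF e]) (rule that)
  have "\<forall>\<^sub>F n in sequentially. 1 - d < r n"
    using r(3) d by (intro order_tendstoD) auto
  then obtain N where N: "\<And>n. n \<ge> N \<Longrightarrow> 1 - d < r n"
    unfolding eventually_sequentially by blast
  define Z where "Z = {t. 0 < t \<and> t < 1 \<and> K (cis (2 * pi * t)) = 0}"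
  define S where "S = {e..1-e} - Z"
  have S: "integral {e..1-e} f = integral S f" "f integrable_on {e..1-e} \<longleftrightarrow> f integrable_on S" for f :: "real \<Rightarrow> real"
  proof -
    have "negligible ({e..1-e} - S)"
      by (rule negligible_subset[OF negligible_boundary_zeros]) (auto simp: S_def Z_def)
    moreover have "S \<subseteq> {e..1-e}" by (auto simp: S_def)
    ultimately show "integral {e..1-e} f = integral S f"
      by (intro integral_subset_negligible[symmetric])
    have "negligible {x \<in> {e..1-e} - S. f x \<noteq> 0}" "negligible {x \<in> S - {e..1-e}. f x \<noteq> 0}"
      by (auto intro: negligible_subset[OF \<open>negligible ({e..1-e} - S)\<close>] simp: S_def)
    then show "f integrable_on {e..1-e} \<longleftrightarrow> f integrable_on S"
      using integrable_spike_set by blast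
  qed
  \<comment> \<open>The shift by \<open>N\<close> makes the majorant valid from the first index
    on.\<close>
  have "(\<lambda>n. integral S (L (r (n + N)))) \<longlonglongrightarrow> integral S (L 1)"
  proof (rule dominated_convergence(2))
    show "L (r (n + N)) integrable_on S" for n
      unfolding S(2)[symmetric] using r nz by (intro integrable_continuous_interval continuous_L) auto
    show "(\<lambda>t. L 1 t - ln c) integrable_on S"
      unfolding S(2)[symmetric] using L_integrable_arc[OF e] by (intro integrable_diff) auto
    fix t assume "t \<in> S"
    then have t: "t \<in> {e..1-e}" "0 < t" "t < 1" "K (cis (2 * pi * t)) \<noteq> 0"
      using e by (auto simp: S_def Z_def)
    show "(\<lambda>n. L (r (n + N)) t) \<longlonglongrightarrow> L 1 t"
      using L_tendsto[OF r(3) t(2,3,4)] by (rule LIMSEQ_ignore_initial_segment)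
    fix n
    have "0 \<le> L (r (n + N)) t" using r less_imp_le by (intro L_nonneg) blast+
    moreover have "c * cmod (K (cis (2 * pi * t))) \<le> cmod (K (of_real (r (n + N)) * cis (2 * pi * t)))"
      using r N[of "n + N"] t by (intro dc) (auto simp: less_imp_le)
    then have "ln (c * cmod (K (cis (2 * pi * t)))) \<le> ln (cmod (K (of_real (r (n + N)) * cis (2 * pi * t))))"
      using c t by (intro ln_mono) auto
    then have "L (r (n + N)) t \<le> L 1 t - ln c"
      using c t by (simp add: L_def ln_mult)
    ultimately show "norm (L (r (n + N)) t) \<le> L 1 t - ln c" by simp
  qed
  then show ?thesis
    unfolding S(1) by (rule LIMSEQ_offset)
qed

text \<open>The Poisson formula at the real point \<open>x\<close> controls the part of the mass that could escape
  to the singular boundary point \<open>1\<close>.\<close>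

lemma mean_le_arc_plus_escape:
  assumes nz: "\<And>w. cmod w < 1 \<Longrightarrow> K w \<noteq> 0" and x: "0 < x" "x < 1" and r: "0 < r" "r < 1"
    and e: "e = (1 - x) / (2 * pi)"
  shows "- ln (cmod (K 0)) \<le> integral {e..1-e} (L r) + 4 * (1 - x) * L (r * x) 0"
proof -
  obtain g where g: "g holomorphic_on ball 0 1" and eg: "\<And>w. w \<in> ball 0 1 \<Longrightarrow> exp (g w) = K w"
    using holomorphic_logarithm_exists[of "ball 0 1" K 0] hol_ball nz by auto
  have lnK: "ln (cmod (K w)) = Re (g w)" if "cmod w < 1" for w
    using eg[of w, symmetric] that by simp
  have lnL: "L q t = - Re (g (of_real q * cis (2 * pi * t)))" if "0 \<le> q" "q < 1" for q t
    unfolding L_def using that by (subst lnK) (auto simp: norm_mult)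
  define P where "P = (\<lambda>t. (1 - x\<^sup>2) / (cmod (cis (2 * pi * t) - of_real x))\<^sup>2)"
  have x2: "0 < 1 - x\<^sup>2" using x by (simp add: power_less_one_iff)
  have Lr: "L r = (\<lambda>t. - Re (g (of_real r * cis (2 * pi * t))))"
    using lnL r by (intro ext) auto
  have mean: "(L r has_integral - ln (cmod (K 0))) {0..1}"
    using has_integral_neg[OF mean_value_disc[OF g r]] lnK[of 0] by (simp add: Lr)
  have rx: "0 \<le> r * x" "r * x < 1"
    using r x mult_strict_mono[of r 1 x 1] by auto
  have poisson: "((\<lambda>t. P t * L r t) has_integral L (r * x) 0) {0..1}"
    using has_integral_neg[OF poisson_formula_disc[OF g r, of x]] r x rx
    by (simp add: Lr lnL[OF rx] P_def)
  \<comment> \<open>A lower bound for the Poisson kernel outside the arc: there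
    \<open>cis (2 * pi * t)\<close> is within \<open>2 * pi * e = 1 - x\<close> of 1, hence within
    \<open>2 * (1 - x)\<close> of \<open>x\<close>.\<close>
  define k where "k = (1 - x\<^sup>2) / (2 * (1 - x))\<^sup>2"
  have k: "0 < k" using x x2 by (simp add: k_def)
  have e01: "0 < e" "e < 1/2"
    using x pi_gt3 by (auto simp: e field_simps)
  have arc: "(L r has_integral integral {e..1-e} (L r)) {e..1-e}"
    using r nz by (intro integrable_integral integrable_continuous_interval continuous_L) auto
  have "((\<lambda>t. if t \<in> {e..1-e} then L r t else 0) has_integral integral {e..1-e} (L r)) {0..1}"
    using arc e01 by (subst has_integral_restrict) auto
  note rhs = has_integral_add[OF poisson has_integral_mult_right[OF this, of k]]
  \<comment> \<open>Pointwise comparison: on the arc the second summand suffices, off the arc the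
    Poisson kernel is at least \<open>k\<close>.\<close>
  have "k * - ln (cmod (K 0)) \<le> L (r * x) 0 + k * integral {e..1-e} (L r)"
  proof (rule has_integral_le[OF has_integral_mult_right[OF mean, of k] rhs])
    fix t :: real assume t: "t \<in> {0..1}"
    have L0: "0 \<le> L r t" using r by (intro L_nonneg) auto
    have P0: "0 \<le> P t" using x2 by (simp add: P_def)
    show "k * L r t \<le> P t * L r t + k * (if t \<in> {e..1-e} then L r t else 0)"
    proof (cases "t \<in> {e..1-e}")
      case True then show ?thesis using L0 P0 by simp
    next
      case False
      have "cmod (cis (2 * pi * t) - 1) \<le> 2 * pi * e"
      proof (cases "t < e")
        case True
        have "\<bar>2 * pi * t\<bar> \<le> 2 * pi * e" using True t by (simp add: abs_mult)
        then show ?thesis using norm_cis_minus_1_le[of "2 * pi * t"] by linarith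
      next
        case False
        with \<open>t \<notin> {e..1-e}\<close> have "1 - t \<le> e" by auto
        then have "\<bar>2 * pi * (t - 1)\<bar> \<le> 2 * pi * e" using t by (simp add: abs_mult)
        moreover have "cis (2 * pi * t) = cis (2 * pi * (t - 1))"
          by (simp add: right_diff_distrib cis_divide[symmetric])
        ultimately show ?thesis using norm_cis_minus_1_le[of "2 * pi * (t - 1)"] by simp
      qed
      also have "2 * pi * e = 1 - x" by (simp add: e)
      finally have "cmod (cis (2 * pi * t) - of_real x) \<le> 2 * (1 - x)"
        using norm_triangle_ineq[of "cis (2 * pi * t) - 1" "1 - of_real x"] x norm_of_real[of "1 - x", where 'a = complex]
        by simp
      moreover have "cis (2 * pi * t) - of_real x \<noteq> 0"
        using x by (metis abs_of_pos eq_iff_diff_eq_0 norm_cis norm_of_real order_less_irrefl)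
      ultimately have "k \<le> P t"
        unfolding k_def P_def using x2 x by (intro divide_left_mono power_mono mult_pos_pos) auto
      then show ?thesis using False L0 P0 by (auto simp: mult_right_mono)
    qed
  qed
  then have "- ln (cmod (K 0)) \<le> integral {e..1-e} (L r) + 1 / k * L (r * x) 0"
    using k by (simp add: field_simps)
  also have "1 / k = 4 * (1 - x) / (1 + x)"
    unfolding k_def using x x2 by (simp add: divide_simps) (simp add: power2_eq_square algebra_simps)
  also have "4 * (1 - x) / (1 + x) * L (r * x) 0 \<le> 4 * (1 - x) * L (r * x) 0"
    using L_nonneg[of "r * x" 0] rx x divide_left_mono[of 1 "1 + x" "4 * (1 - x)"]
    by (intro mult_right_mono) auto
  finally show ?thesis by simp
qed

text \<open>Two limits in succession: with \<open>x\<close> and its arc fixed, the radii tend to 1;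
  then \<open>x\<close> tends to 1, and \<open>slow\<close> makes the escape term vanish.\<close>

lemma integral_L_1_ge:
  assumes nz: "\<And>w. cmod w < 1 \<Longrightarrow> K w \<noteq> 0"
  shows "- ln (cmod (K 0)) \<le> integral {0<..<1} (L 1)"
proof -
  have *: "- ln (cmod (K 0)) \<le> integral {0<..<1} (L 1) - 4 * ((1 - x) * ln (cmod (K (of_real x))))"
    if x: "0 < x" "x < 1" for x
  proof -
    define e where "e = (1 - x) / (2 * pi)"
    have e: "0 < e" using x by (simp add: e_def)
    obtain r where r: "\<And>n. 0 < r n" "\<And>n. 0 < r n" "\<And>n. r n < 1" "r \<longlonglongrightarrow> 1"
        "\<And>n w. cmod w = r n \<Longrightarrow> K w \<noteq> 0"
      by (rule good_radii[OF zero_less_one]) (rule that)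
    have cont: "isCont K (of_real x)"
      using continuous_on_interior[OF holomorphic_on_imp_continuous_on[OF hol_ball]] x by simp
    have "(\<lambda>n. complex_of_real (r n * x)) \<longlonglongrightarrow> of_real (1 * x)"
      by (intro tendsto_intros r)
    then have "(\<lambda>n. K (of_real (r n * x))) \<longlonglongrightarrow> K (of_real x)"
      using isCont_tendsto_compose[OF cont] by simp
    then have "(\<lambda>n. L (r n * x) 0) \<longlonglongrightarrow> - ln (cmod (K (of_real x)))"
      unfolding L_def using nz[of "of_real x"] x by (intro tendsto_intros) auto
    then have "(\<lambda>n. integral {e..1-e} (L (r n)) + 4 * (1 - x) * L (r n * x) 0)
        \<longlonglongrightarrow> integral {e..1-e} (L 1) + 4 * (1 - x) * - ln (cmod (K (of_real x)))"
      by (intro tendsto_intros integral_arc_tendsto nz e r(1,3,4))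
    then have "- ln (cmod (K 0)) \<le> integral {e..1-e} (L 1) + 4 * (1 - x) * - ln (cmod (K (of_real x)))"
      using mean_le_arc_plus_escape[OF nz x r(1,3) e_def] by (intro LIMSEQ_le_const) auto
    also have "integral {e..1-e} (L 1) \<le> integral {0<..<1} (L 1)"
    proof (rule integral_subset_le[OF _ _ L_integrable])
      show "{e..1-e} \<subseteq> {0<..<1}" using e by auto
      show "L 1 integrable_on {e..1-e}"
        by (rule L_integrable_arc[OF e])
    qed (auto intro: L_nonneg)
    finally show ?thesis by (simp add: algebra_simps)
  qed
  have "((\<lambda>x. integral {0<..<1} (L 1) - 4 * ((1 - x) * ln (cmod (K (of_real x))))) \<longlongrightarrow> integral {0<..<1} (L 1) - 4 * 0) (at_left 1)"
    by (intro tendsto_intros slow)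
  then have "- ln (cmod (K 0)) \<le> integral {0<..<1} (L 1) - 4 * 0"
  proof (rule tendsto_lowerbound)
    show "\<forall>\<^sub>F x in at_left 1. - ln (cmod (K 0)) \<le> integral {0<..<1} (L 1) - 4 * ((1 - x) * ln (cmod (K (of_real x))))"
      using eventually_at_left_real[of 0 1] by (auto elim!: eventually_mono intro: *)
  qed simp
  then show ?thesis by simp
qed

lemma integral_L_1_eq_iff:
  "integral {0<..<1} (L 1) = - ln (cmod (K 0)) \<longleftrightarrow> (\<forall>w. cmod w < 1 \<longrightarrow> K w \<noteq> 0)"
  using integral_L_1_le integral_L_1_less integral_L_1_ge by (metis order_antisym order_less_irrefl)

end

section \<open>Transfer to the half-plane\<close>

definition cayley :: "real \<Rightarrow> real \<Rightarrow> complex \<Rightarrow> complex" where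
  "cayley a b w = of_real b + of_real a * ((1 + w) / (1 - w))"

lemma cayley_inverse:
  assumes "a > 0" "w \<noteq> 1"
  shows "(cayley a b w - of_real b - of_real a) / (cayley a b w - of_real b + of_real a) = w"
proof -
  have nz: "1 - w \<noteq> 0" "complex_of_real a \<noteq> 0" using assms by auto
  have "cayley a b w - of_real b - of_real a = 2 * of_real a * w / (1 - w)"
    using nz by (simp add: cayley_def field_simps)
  moreover have "cayley a b w - of_real b + of_real a = 2 * of_real a / (1 - w)"
    using nz by (simp add: cayley_def field_simps)
  ultimately show ?thesis using nz by simp
qed

lemma Re_cayley:
  "Re (cayley a b w) = b + a * ((1 - (cmod w)\<^sup>2) / (cmod (1 - w))\<^sup>2)"
proof -
  have "(1 + w) / (1 - w) = (1 + w) * cnj (1 - w) / of_real ((cmod (1 - w))\<^sup>2)"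
    by (metis complex_div_cnj of_real_power)
  then have "Re ((1 + w) / (1 - w)) = Re ((1 + w) * cnj (1 - w)) / (cmod (1 - w))\<^sup>2"
    by (simp only: Re_divide_of_real)
  also have "Re ((1 + w) * cnj (1 - w)) = 1 - (cmod w)\<^sup>2"
    unfolding cmod_power2 by (simp add: algebra_simps power2_eq_square)
  finally have "Re ((1 + w) / (1 - w)) = (1 - (cmod w)\<^sup>2) / (cmod (1 - w))\<^sup>2" .
  moreover have "Re (of_real b + of_real a * z) = b + a * Re z" for z by simp
  ultimately show ?thesis unfolding cayley_def by (simp only:)
qed

text \<open>With \<open>z = s - b\<close> the preimage is \<open>(z - a) / (z + a)\<close>; it lies
  in the disc because a point with positive real part is closer to \<open>a\<close> than to
  \<open>- a\<close>.\<close>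

lemma cayley_surj:
  assumes a: "a > 0" and s: "Re s > b"
  obtains w where "cmod w < 1" "cayley a b w = s"
proof
  define z where "z = s - of_real b"
  have z: "Re z > 0" using s by (simp add: z_def)
  have nz: "z + of_real a \<noteq> 0" using z a by (auto simp: complex_eq_iff)
  have "(cmod (z - of_real a))\<^sup>2 < (cmod (z + of_real a))\<^sup>2"
    using z a unfolding cmod_power2 by (simp add: power2_eq_square algebra_simps)
  then have "cmod (z - of_real a) < cmod (z + of_real a)"
    by (rule power2_less_imp_less) simp
  then show "cmod ((z - of_real a) / (z + of_real a)) < 1"
    using nz by (simp add: norm_divide)
  have "1 + (z - of_real a) / (z + of_real a) = 2 * z / (z + of_real a)"
    using nz by (simp add: field_simps)
  moreover have "1 - (z - of_real a) / (z + of_real a) = 2 * of_real a / (z + of_real a)"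
    using nz by (simp add: field_simps)
  ultimately have "(1 + (z - of_real a) / (z + of_real a)) / (1 - (z - of_real a) / (z + of_real a)) = z / of_real a"
    using nz a by simp
  then show "cayley a b ((z - of_real a) / (z + of_real a)) = s"
    unfolding cayley_def using a by (simp only:) (simp add: z_def)
qed

text \<open>With half angle \<open>pi * t\<close>, the quotient \<open>(1 + w) / (1 - w)\<close> on
  the circle equals \<open>\<i> * cot (pi * t)\<close>.\<close>

lemma cayley_cis:
  assumes "0 < t" "t < 1"
  shows "cayley a b (cis (2 * pi * t)) = Complex b (a * cot (pi * t))"
proof -
  define c s where "c = cos (pi * t)" and "s = sin (pi * t)"
  have s: "s > 0" unfolding s_def using assms by (intro sin_gt_zero) auto
  have cs: "c\<^sup>2 + s\<^sup>2 = 1" by (simp add: c_def s_def)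
  have w: "cis (2 * pi * t) = Complex (c\<^sup>2 - s\<^sup>2) (2 * s * c)"
    using cos_double[of "pi * t"] sin_double[of "pi * t"] by (simp add: complex_eq_iff c_def s_def mult.assoc)
  have "1 + cis (2 * pi * t) = \<i> * of_real (c / s) * (1 - cis (2 * pi * t))"
    using s cs unfolding w by (simp add: complex_eq_iff field_simps power2_eq_square) algebra
  then have "(1 + cis (2 * pi * t)) / (1 - cis (2 * pi * t)) = \<i> * of_real (cot (pi * t))"
    using cis_2pi_neq_1[OF assms] by (simp add: cot_def c_def s_def)
  then show ?thesis unfolding cayley_def by (simp only:) (simp add: complex_eq_iff)
qed

section \<open>Change of variables between the line and the circle\<close>

text \<open>For \<open>\<tau> = a * cot (pi * t)\<close> one has \<open>a\<^sup>2 + \<tau>\<^sup>2 =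
  a\<^sup>2 / (sin (pi * t))\<^sup>2\<close>, so the Jacobian cancels the Poisson kernel
  exactly.\<close>

lemma cot_substitution:
  assumes a: "a > 0"
  shows "(\<lambda>\<tau>. a / pi * (f \<tau> / (a\<^sup>2 + \<tau>\<^sup>2))) absolutely_integrable_on UNIV \<and>
         integral UNIV (\<lambda>\<tau>. a / pi * (f \<tau> / (a\<^sup>2 + \<tau>\<^sup>2))) = I
     \<longleftrightarrow> (\<lambda>t. f (a * cot (pi * t))) absolutely_integrable_on {0<..<1} \<and>
         integral {0<..<1} (\<lambda>t. f (a * cot (pi * t))) = I"
proof -
  define g where "g = (\<lambda>t. a * cot (pi * t))"
  define g' where "g' = (\<lambda>t. - (a * pi / (sin (pi * t))\<^sup>2))"
  define F where "F = (\<lambda>\<tau>. a / pi * (f \<tau> / (a\<^sup>2 + \<tau>\<^sup>2)))"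
  have sin: "sin (pi * t) > 0" if "t \<in> {0<..<1}" for t
    using that by (intro sin_gt_zero) auto
  have der: "(g has_field_derivative g' t) (at t within {0<..<1})" if "t \<in> {0<..<1}" for t
  proof -
    have "((\<lambda>t. cot (pi * t)) has_field_derivative - inverse ((sin (pi * t))\<^sup>2) * pi) (at t within {0<..<1})"
      using sin[OF that]
      by (intro DERIV_chain2[OF DERIV_cot]) (auto intro!: derivative_eq_intros)
    from DERIV_cmult[OF this, of a] show ?thesis
      unfolding g_def g'_def by (simp add: field_simps)
  qed
  have inj: "inj_on g {0<..<1}"
  proof (rule inj_onI)
    fix s t :: real assume st: "s \<in> {0<..<1}" "t \<in> {0<..<1}" "g s = g t"
    then have "cayley a 0 (cis (2 * pi * s)) = cayley a 0 (cis (2 * pi * t))"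
      by (simp add: cayley_cis g_def)
    then have "cis (2 * pi * s) = cis (2 * pi * t)"
      using cayley_inverse[OF a] cis_2pi_neq_1 st by (metis greaterThanLessThan_iff)
    then show "s = t" using st by (intro cis_2pi_inj) auto
  qed
  have img: "g ` {0<..<1} = UNIV"
  proof (intro equalityI subsetI)
    fix \<tau> :: real
    define y where "y = arctan (\<tau> / a)"
    have y: "- (pi / 2) < y" "y < pi / 2" "tan y = \<tau> / a"
      unfolding y_def by (rule arctan_lbound arctan_ubound tan_arctan)+
    \<comment> \<open>The preimage comes from \<open>cot (pi / 2 - y) = tan y\<close>.\<close>
    have "g (1 / 2 - y / pi) = a * cot (pi / 2 - y)"
      by (simp add: g_def algebra_simps)
    also have "\<dots> = \<tau>" using y a by (simp add: cot_def tan_def cos_diff sin_diff)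
    finally show "\<tau> \<in> g ` {0<..<1}"
      using y by (intro image_eqI[of _ _ "1 / 2 - y / pi"]) (auto simp: field_simps)
  qed auto
  have eq: "\<bar>g' t\<bar> * F (g t) = f (g t)" if "t \<in> {0<..<1}" for t
  proof -
    define c s where "c = cos (pi * t)" and "s = sin (pi * t)"
    have s: "s > 0" using sin[OF that] by (simp add: s_def)
    have "c\<^sup>2 + s\<^sup>2 = 1" by (simp add: c_def s_def)
    then have "a\<^sup>2 + (a * (c / s))\<^sup>2 = a\<^sup>2 / s\<^sup>2"
      using s by (simp add: power_mult_distrib power_divide field_simps) algebra
    then have "a\<^sup>2 + (g t)\<^sup>2 = a\<^sup>2 / s\<^sup>2" by (simp add: g_def cot_def c_def s_def)
    moreover have "\<bar>g' t\<bar> = a * pi / s\<^sup>2" using a by (simp add: g'_def s_def)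
    ultimately show ?thesis using a s by (simp add: F_def power2_eq_square)
  qed
  have "(\<lambda>t. \<bar>g' t\<bar> * F (g t)) absolutely_integrable_on {0<..<1} \<and>
           integral {0<..<1} (\<lambda>t. \<bar>g' t\<bar> * F (g t)) = I
     \<longleftrightarrow> F absolutely_integrable_on (g ` {0<..<1}) \<and> integral (g ` {0<..<1}) F = I"
    by (rule has_absolute_integral_change_of_variables_1'[OF _ der inj]) auto
  moreover have "integral {0<..<1} (\<lambda>t. \<bar>g' t\<bar> * F (g t)) = integral {0<..<1} (\<lambda>t. f (g t))"
    by (rule integral_cong) (rule eq)
  moreover have "(\<lambda>t. \<bar>g' t\<bar> * F (g t)) absolutely_integrable_on {0<..<1}
      \<longleftrightarrow> (\<lambda>t. f (g t)) absolutely_integrable_on {0<..<1}"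
    using eq by (intro set_integrable_cong) auto
  ultimately have "F absolutely_integrable_on UNIV \<and> integral UNIV F = I
      \<longleftrightarrow> (\<lambda>t. f (g t)) absolutely_integrable_on {0<..<1} \<and> integral {0<..<1} (\<lambda>t. f (g t)) = I"
    by (simp only: img)
  then show ?thesis unfolding F_def g_def .
qed

section \<open>The two functions to which the disc theorem is applied\<close>

text \<open>This function has no zero in the disc, so the disc theorem evaluates its boundary mean;
  that is how the auxiliary factor \<open>(1 - w)\<^sup>2\<close> is later removed.\<close>

lemma slow_bounded_disc_square: "slow_bounded_disc (\<lambda>w. (1 - w)\<^sup>2 / 4)"
proof
  show "(\<lambda>w. (1 - w)\<^sup>2 / 4) holomorphic_on - {1}" by (intro holomorphic_intros) auto
  show "cmod ((1 - w)\<^sup>2 / 4) \<le> 1" if "cmod w \<le> 1" for w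
  proof -
    have "cmod (1 - w) \<le> 2" using norm_triangle_ineq4[of 1 w] that by simp
    then have "(cmod (1 - w))\<^sup>2 \<le> 2\<^sup>2" by (intro power_mono) auto
    then show ?thesis by (simp add: norm_divide norm_power)
  qed
  have "((\<lambda>x::real. (1 - x) * ln ((1 - x)\<^sup>2 / 4)) \<longlongrightarrow> 0) (at_left 1)" by real_asymp
  moreover have "cmod ((1 - of_real x)\<^sup>2 / 4) = (1 - x)\<^sup>2 / 4" for x
    using norm_of_real[of "(1 - x)\<^sup>2 / 4", where 'a = complex] by simp
  ultimately show "((\<lambda>x. (1 - x) * ln (cmod ((1 - of_real x)\<^sup>2 / 4))) \<longlongrightarrow> 0) (at_left 1)"
    by simp
qed auto

text \<open>The factor \<open>(1 - w)\<^sup>2\<close> absorbs the quadratic growth, since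
  \<open>(1 - w) * cayley a b w\<close> is bounded in the disc. \<open>K 0\<close> is nonzero by the
  results on the real axis, with \<open>a + b\<close> on either side of 1.\<close>

lemma slow_bounded_disc_zeta:
  assumes a: "a > 0" and b: "1/2 \<le> b" "b < 1" and ab: "a + b \<noteq> 1"
  obtains C where "C > 0" "slow_bounded_disc (\<lambda>w. zeta_reg (cayley a b w) * (1 - w)\<^sup>2 / of_real C)"
proof -
  obtain C0 where C0: "C0 > 0" "\<And>s. Re s \<ge> 1/2 \<Longrightarrow> cmod (zeta_reg s) \<le> C0 * (1 + cmod s)\<^sup>2"
    by (rule zeta_reg_growth) (rule that)
  \<comment> \<open>A bound for \<open>cmod (1 - w) * (1 + cmod (cayley a b w))\<close> on the
    closed disc without 1, from \<open>cmod (1 - w) \<le> 2\<close> and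
    \<open>cmod (1 + w) \<le> 2\<close>.\<close>
  define k where "k = 2 + 2 * b + 2 * a"
  define C where "C = C0 * k\<^sup>2"
  have k: "k > 0" using a b by (simp add: k_def)
  have C: "C > 0" using C0 k by (simp add: C_def)
  define K where "K = (\<lambda>w. zeta_reg (cayley a b w) * (1 - w)\<^sup>2 / of_real C)"
  have bd: "cmod (K w) \<le> 1" if w: "cmod w \<le> 1" "w \<noteq> 1" for w
  proof -
    have "Re (cayley a b w) \<ge> b"
      unfolding Re_cayley using a w by (auto intro!: divide_nonneg_nonneg mult_nonneg_nonneg simp: power_le_one)
    then have "cmod (zeta_reg (cayley a b w)) \<le> C0 * (1 + cmod (cayley a b w))\<^sup>2"
      using b by (intro C0) auto
    then have "cmod (zeta_reg (cayley a b w)) * (cmod (1 - w))\<^sup>2 \<le> C0 * (1 + cmod (cayley a b w))\<^sup>2 * (cmod (1 - w))\<^sup>2"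
      by (intro mult_right_mono) auto
    also have "\<dots> = C0 * (cmod (1 - w) * (1 + cmod (cayley a b w)))\<^sup>2"
      by (simp add: power_mult_distrib)
    also have "cmod (1 - w) * (1 + cmod (cayley a b w)) \<le> k"
    proof -
      have "(1 - w) * cayley a b w = of_real b * (1 - w) + of_real a * (1 + w)"
        using w by (simp add: cayley_def field_simps)
      then have "cmod (1 - w) * cmod (cayley a b w) = cmod (of_real b * (1 - w) + of_real a * (1 + w))"
        by (metis norm_mult)
      also have "\<dots> \<le> b * cmod (1 - w) + a * cmod (1 + w)"
        using norm_triangle_ineq[of "of_real b * (1 - w)" "of_real a * (1 + w)"] a b by (simp add: norm_mult)
      also have "\<dots> \<le> b * 2 + a * 2"
        using norm_triangle_ineq4[of 1 w] norm_triangle_ineq[of 1 w] a b w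
        by (intro add_mono mult_left_mono) auto
      finally show ?thesis
        using norm_triangle_ineq4[of 1 w] w by (simp add: k_def distrib_left)
    qed
    then have "C0 * (cmod (1 - w) * (1 + cmod (cayley a b w)))\<^sup>2 \<le> C"
      unfolding C_def using C0(1) by (intro mult_left_mono power_mono) auto
    finally show ?thesis using C by (simp add: K_def norm_mult norm_divide norm_power)
  qed
  have "slow_bounded_disc K"
  proof
    have "(zeta_reg \<circ> cayley a b) holomorphic_on - {1}"
      unfolding cayley_def
      by (rule holomorphic_on_compose_gen[OF _ zeta_reg_holomorphic]) (auto intro!: holomorphic_intros)
    then show "K holomorphic_on - {1}"
      unfolding K_def using C by (intro holomorphic_intros) (auto simp: o_def)
    show "cmod (K w) \<le> 1" if "cmod w \<le> 1" "w \<noteq> 1" for w using bd that .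
    have "zeta_reg (of_real (a + b)) \<noteq> 0"
      using zeta_reg_real_ge[of "a + b"] zeta_reg_unit_interval[of "a + b"] ab a b by (cases "a + b < 1") auto
    then show "K 0 \<noteq> 0" using C by (simp add: K_def cayley_def add.commute)
    show "((\<lambda>x. (1 - x) * ln (cmod (K (of_real x)))) \<longlongrightarrow> 0) (at_left 1)"
    proof (rule tendsto_sandwich)
      show "((\<lambda>x. (1 - x) * (2 * ln (1 - x) - ln C)) \<longlongrightarrow> 0) (at_left 1)" by real_asymp
      show "((\<lambda>x. 0) \<longlongrightarrow> 0) (at_left (1::real))" by simp
      have "filterlim (\<lambda>x. b + a * ((1 + x) / (1 - x))) at_top (at_left 1)"
        using a by real_asymp
      \<comment> \<open>Real points with image at least 2 have \<open>zeta_reg\<close> of modulus at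
        least 1, so only the factor \<open>(1 - x)\<^sup>2 / C\<close> can make \<open>K\<close>
        small, and its logarithm is slow.\<close>
      then have "\<forall>\<^sub>F x in at_left 1. 2 \<le> b + a * ((1 + x) / (1 - x))"
        by (simp add: filterlim_at_top)
      moreover have "\<forall>\<^sub>F x::real in at_left 1. x \<in> {0<..<1}"
        by (rule eventually_at_left_real) simp
      ultimately have ev: "\<forall>\<^sub>F x in at_left 1. (1 - x)\<^sup>2 / C \<le> cmod (K (of_real x)) \<and> cmod (K (of_real x)) \<le> 1 \<and> 0 < x \<and> x < 1"
      proof eventually_elim
        case (elim x)
        define y where "y = b + a * ((1 + x) / (1 - x))"
        have "cayley a b (of_real x) = of_real y" by (simp add: cayley_def y_def)
        moreover have "1 \<le> cmod (zeta_reg (of_real y))"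
          using zeta_reg_real_ge[of y] elim by (simp add: y_def)
        then have "1 * (1 - x)\<^sup>2 / C \<le> cmod (zeta_reg (of_real y)) * (1 - x)\<^sup>2 / C"
          using C by (intro divide_right_mono mult_right_mono) auto
        moreover have "cmod (1 - complex_of_real x) = 1 - x"
          using norm_of_real[of "1 - x", where 'a = complex] elim by simp
        ultimately show ?case
          using elim bd[of "of_real x"] C by (simp add: K_def norm_mult norm_divide norm_power)
      qed
      show "\<forall>\<^sub>F x in at_left 1. (1 - x) * (2 * ln (1 - x) - ln C) \<le> (1 - x) * ln (cmod (K (of_real x)))"
        using ev
      proof eventually_elim
        case (elim x)
        have "ln ((1 - x)\<^sup>2 / C) \<le> ln (cmod (K (of_real x)))"
          using elim C by (intro ln_mono) auto
        moreover have "ln ((1 - x)\<^sup>2 / C) = 2 * ln (1 - x) - ln C"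
          using elim C by (simp add: ln_div ln_realpow)
        ultimately show ?case using elim by (intro mult_left_mono) auto
      qed
      show "\<forall>\<^sub>F x in at_left 1. (1 - x) * ln (cmod (K (of_real x))) \<le> 0"
        using ev
      proof eventually_elim
        case (elim x)
        then have "0 < (1 - x)\<^sup>2 / C" using C by simp
        with elim have "0 < cmod (K (of_real x))" "cmod (K (of_real x)) \<le> 1" by linarith+
        then have "ln (cmod (K (of_real x))) \<le> 0" by (simp only: ln_le_zero_iff)
        then show ?case using elim by (simp add: mult_nonneg_nonpos)
      qed
    qed
  qed
  with C that show thesis unfolding K_def by blast
qed

text \<open>Excluding \<open>s = 1\<close> on the right loses nothing, because
  \<open>zeta_reg 1 = 1\<close>; the factor \<open>(1 - w)\<^sup>2\<close> has no zero in the open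
  disc.\<close>

lemma zeta_reg_no_zeros_iff:
  assumes a: "a > 0" and b: "b < 1" and C: "C > 0"
  shows "(\<forall>w. cmod w < 1 \<longrightarrow> zeta_reg (cayley a b w) * (1 - w)\<^sup>2 / of_real C \<noteq> 0)
     \<longleftrightarrow> (\<forall>s. b < Re s \<and> s \<noteq> 1 \<longrightarrow> riemann_zeta s \<noteq> 0)"
proof
  assume L: "\<forall>w. cmod w < 1 \<longrightarrow> zeta_reg (cayley a b w) * (1 - w)\<^sup>2 / of_real C \<noteq> 0"
  show "\<forall>s. b < Re s \<and> s \<noteq> 1 \<longrightarrow> riemann_zeta s \<noteq> 0"
  proof clarify
    fix s assume s: "b < Re s" "s \<noteq> 1" "riemann_zeta s = 0"
    obtain w where w: "cmod w < 1" "cayley a b w = s" using cayley_surj[OF a s(1)] by blast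
    then have "zeta_reg s \<noteq> 0" using L by auto
    then show False using s by (simp add: zeta_reg_def)
  qed
next
  assume R: "\<forall>s. b < Re s \<and> s \<noteq> 1 \<longrightarrow> riemann_zeta s \<noteq> 0"
  show "\<forall>w. cmod w < 1 \<longrightarrow> zeta_reg (cayley a b w) * (1 - w)\<^sup>2 / of_real C \<noteq> 0"
  proof (intro allI impI)
    fix w assume w: "cmod w < 1"
    then have w1: "w \<noteq> 1" by auto
    have "(cmod w)\<^sup>2 < 1" using w by (simp add: power_less_one_iff)
    then have "b < Re (cayley a b w)" unfolding Re_cayley using a w1 by simp
    then have "zeta_reg (cayley a b w) \<noteq> 0" using R by (simp add: zeta_reg_def)
    then show "zeta_reg (cayley a b w) * (1 - w)\<^sup>2 / of_real C \<noteq> 0" using C w1 by simp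
  qed
qed

text \<open>\<open>has_integral\<close> asserts existence and value together; existence always holds
  by integrability of \<open>L 1\<close>, so the equivalence concerns the value. Zeros on the line
  \<open>Re s = b\<close> only affect a null set of the integral. The condition
  \<open>s \<noteq> 1\<close> excludes the pole, where the value of \<open>riemann_zeta\<close> is
  unspecified.\<close>

theorem theorem3:
  fixes a b :: real
  assumes "a > 0" and "1/2 \<le> b" and "b < 1" and "a + b \<noteq> 1"
  shows "((\<lambda>t::real. (a / pi) *
             (ln (cmod (riemann_zeta (Complex b t) * Complex (b - 1) t)) / (a\<^sup>2 + t\<^sup>2)))
           has_integral ln (cmod (riemann_zeta (complex_of_real (a + b)) * complex_of_real (a + b - 1)))) UNIV
         \<longleftrightarrow> (\<forall>s. b < Re s \<and> s \<noteq> 1 \<longrightarrow> riemann_zeta s \<noteq> 0)"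
proof -
  define u where "u = (\<lambda>t. ln (cmod (zeta_reg (Complex b t))))"
  have u: "ln (cmod (riemann_zeta (Complex b t) * Complex (b - 1) t)) = u t" for t
  proof -
    have "Complex b t \<noteq> 1" "Complex b t - 1 = Complex (b - 1) t"
      using assms by (auto simp: complex_eq_iff)
    then show ?thesis by (simp add: u_def zeta_reg_def mult.commute)
  qed
  define v where "v = ln (cmod (zeta_reg (of_real (a + b))))"
  have v: "ln (cmod (riemann_zeta (complex_of_real (a + b)) * complex_of_real (a + b - 1))) = v"
    using assms(4) by (simp add: v_def zeta_reg_def mult.commute flip: of_real_add)
  obtain C where C: "C > 0"
    and disc: "slow_bounded_disc (\<lambda>w. zeta_reg (cayley a b w) * (1 - w)\<^sup>2 / of_real C)"
    by (rule slow_bounded_disc_zeta[OF assms]) (rule that)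
  interpret K: slow_bounded_disc "\<lambda>w. zeta_reg (cayley a b w) * (1 - w)\<^sup>2 / of_real C" by (fact disc)
  interpret Q: slow_bounded_disc "\<lambda>w. (1 - w)\<^sup>2 / 4" by (fact slow_bounded_disc_square)
  have "zeta_reg (of_real (a + b)) \<noteq> 0" using K.K0 by (auto simp: cayley_def add.commute)
  then have K0: "- ln (cmod (zeta_reg (cayley a b 0) * (1 - 0)\<^sup>2 / of_real C)) = ln C - v"
    using C by (simp add: cayley_def v_def norm_divide ln_div add.commute)
  have "(\<forall>w. cmod w < 1 \<longrightarrow> (1 - w)\<^sup>2 / 4 \<noteq> 0)" by auto
  then have IQ: "integral {0<..<1} (Q.L 1) = ln 4"
    using Q.integral_L_1_eq_iff by (simp add: norm_divide ln_div)
  define Z where "Z = {t. 0 < t \<and> t < 1 \<and> zeta_reg (cayley a b (cis (2 * pi * t))) * (1 - cis (2 * pi * t))\<^sup>2 / of_real C = 0}"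
  have Z: "negligible Z" unfolding Z_def by (rule K.negligible_boundary_zeros)
  \<comment> \<open>On the circle, \<open>ln\<close> of the modulus of \<open>zeta_reg\<close> is
    that of \<open>K\<close>, minus that of the square factor, plus \<open>ln C - ln 4\<close>; this
    splitting holds off \<open>Z\<close>, where no logarithm is taken at 0.\<close>
  define h where "h = (\<lambda>t. Q.L 1 t - K.L 1 t + (ln C - ln 4))"
  have uh: "u (a * cot (pi * t)) = h t" if "t \<in> {0<..<1} - Z" for t
  proof -
    define q where "q = cmod (1 - cis (2 * pi * t))"
    define m where "m = cmod (zeta_reg (Complex b (a * cot (pi * t))))"
    have t: "0 < t" "t < 1" using that by auto
    have "zeta_reg (cayley a b (cis (2 * pi * t))) \<noteq> 0" using that by (auto simp: Z_def)
    then have qm: "q > 0" "m > 0" using cis_2pi_neq_1[OF t] cayley_cis[OF t, of a b] by (auto simp: q_def m_def)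
    have "K.L 1 t = - ln (m * q\<^sup>2 / C)"
      using C by (simp add: K.L_def cayley_cis[OF t] m_def q_def norm_mult norm_divide norm_power)
    also have "\<dots> = ln C - ln m - ln (q\<^sup>2)" using qm C by (simp add: ln_div ln_mult)
    finally have "K.L 1 t = ln C - ln m - ln (q\<^sup>2)" .
    moreover have "Q.L 1 t = ln 4 - ln (q\<^sup>2)"
      using qm by (simp add: Q.L_def q_def norm_divide norm_power ln_div)
    ultimately show ?thesis by (simp add: h_def u_def m_def)
  qed
  have abs: "Q.L 1 absolutely_integrable_on {0<..<1}" "K.L 1 absolutely_integrable_on {0<..<1}"
    using Q.L_integrable K.L_integrable Q.L_nonneg K.L_nonneg
    by (auto intro!: nonnegative_absolutely_integrable_1)
  have habs: "h absolutely_integrable_on {0<..<1}"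
    unfolding h_def using abs by (intro set_integral_add set_integral_diff absolutely_integrable_on_const) auto
  have "((\<lambda>t. Q.L 1 t - K.L 1 t + (ln C - ln 4)) has_integral
      (integral {0<..<1} (Q.L 1) - integral {0<..<1} (K.L 1) + (ln C - ln 4))) {0<..<1}"
    using has_integral_const_real[of "ln C - ln 4" 0 1]
    by (intro has_integral_add[OF has_integral_diff] integrable_integral Q.L_integrable K.L_integrable)
      (simp add: has_integral_Icc_iff_Ioo)
  then have hint: "integral {0<..<1} h = ln C - integral {0<..<1} (K.L 1)"
    unfolding h_def IQ by (simp add: integral_unique)
  have "(\<lambda>t. u (a * cot (pi * t))) absolutely_integrable_on {0<..<1}"
    using habs Z uh by (rule absolutely_integrable_spike)
  moreover have "integral {0<..<1} (\<lambda>t. u (a * cot (pi * t))) = integral {0<..<1} h"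
    using Z uh by (intro integral_spike) auto
  ultimately have "(\<lambda>\<tau>. a / pi * (u \<tau> / (a\<^sup>2 + \<tau>\<^sup>2))) absolutely_integrable_on UNIV \<and>
         integral UNIV (\<lambda>\<tau>. a / pi * (u \<tau> / (a\<^sup>2 + \<tau>\<^sup>2))) = ln C - integral {0<..<1} (K.L 1)"
    by (intro iffD2[OF cot_substitution[OF assms(1)]]) (simp add: hint)
  then have "((\<lambda>\<tau>. a / pi * (u \<tau> / (a\<^sup>2 + \<tau>\<^sup>2))) has_integral ln C - integral {0<..<1} (K.L 1)) UNIV"
    by (simp add: has_integral_iff set_lebesgue_integral_eq_integral(1))
  \<comment> \<open>The integral is known to exist with an explicit value, so by uniqueness it
    equals \<open>v\<close> exactly when the two numbers agree.\<close>
  then have "((\<lambda>\<tau>. a / pi * (u \<tau> / (a\<^sup>2 + \<tau>\<^sup>2))) has_integral v) UNIV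
      \<longleftrightarrow> integral {0<..<1} (K.L 1) = ln C - v"
    by (auto dest: has_integral_unique)
  also have "\<dots> \<longleftrightarrow> (\<forall>s. b < Re s \<and> s \<noteq> 1 \<longrightarrow> riemann_zeta s \<noteq> 0)"
    using K.integral_L_1_eq_iff zeta_reg_no_zeros_iff[OF assms(1,3) C] unfolding K0 by simp
  finally show ?thesis unfolding u v .
qed

end
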